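(* For $n=1$ fix $\alpha\ge3$, and for $n\ge2$ fix $\alpha>4$. Let $\{\beta_m\}_m\subseteq(1,2)$ be such that $\beta_m\nearrow2$, and define a sequence $\{\mu_m\}_m\subseteq\mathcal{P}(\mathbb{R}^n)$ by $\mu_m\in\operatorname{argmin}_{\mathcal{P}(\mathbb{R}^n)}\mathcal{E}_{\alpha,\beta_m}$. Then every subsequence of $\{\mu_m\}_m$ has a further subsequence which weakly converges to some regular unit simplex.
   Context: $\mathcal{P}(\mathbb{R}^n)$ is the set of probability measures on $\mathbb{R}^n$; weak convergence is convergence against bounded continuous functions. For $\alpha>\beta>0$, $\mathcal{E}_{\alpha,\beta}[\mu]=\frac12\iint_{\mathbb{R}^n\times\mathbb{R}^n}\left(\frac{|x-y|^\alpha}{\alpha}-\frac{|x-y|^\beta}{\beta}\right)d\mu(x)d\mu(y)$, and $\operatorname{argmin}_{\mathcal{P}(\mathbb{R}^n)}\mathcal{E}_{\alpha,\beta}$ is the set of its global minimizers over $\mathcal{P}(\mathbb{R}^n)$. A regular unit simplex (measure) in $\mathbb{R}^n$ is the uniform probability measure on $n+1$ points of $\mathbb{R}^n$ with all pairwise distances equal to $1$.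
   Formalization: The energy is translation invariant, so minimizers may drift to infinity and the claim fails literally; the formal theorem asserts the weak convergence after each minimizer μ_m is translated so that its center of mass is 0. *)

theory Defs
  imports "HOL-Probability.Probability"
begin

text \<open>Borel probability measures on a topological space.\<close>

abbreviation prob_measures :: "'a::topological_space measure set" where
  "prob_measures \<equiv> space (prob_algebra borel)"

text \<open>The library's \<^const>\<open>weak_conv_m\<close> is restricted to the real line (it is
  formulated with distribution functions), hence the following definition.\<close>

definition weakly_converges :: "(nat \<Rightarrow> 'a::topological_space measure) \<Rightarrow> 'a measure \<Rightarrow> bool" where
  "weakly_converges M N \<longleftrightarrow>
     (\<forall>f :: 'a \<Rightarrow> real. continuous_on UNIV f \<and> bounded (range f) \<longrightarrow>
        (\<lambda>m. \<integral>x. f x \<partial>M m) \<longlonglongrightarrow> (\<integral>x. f x \<partial>N))"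

definition kernel :: "real \<Rightarrow> real \<Rightarrow> 'a::euclidean_space \<Rightarrow> 'a \<Rightarrow> real" where
  "kernel \<alpha> \<beta> x y = norm (x - y) powr \<alpha> / \<alpha> - norm (x - y) powr \<beta> / \<beta>"

text \<open>The double integral may be \<open>+\<infinity>\<close>, so it is taken as the extended-real Lebesgue
  integral (positive part minus negative part). For \<open>\<alpha> > \<beta> > 0\<close> the kernel is bounded below
  by \<open>1 / \<alpha> - 1 / \<beta>\<close>; on probability measures the subtracted term is therefore finite
  and \<open>\<infinity> - \<infinity>\<close> does not occur.\<close>

definition energy :: "real \<Rightarrow> real \<Rightarrow> 'a::euclidean_space measure \<Rightarrow> ereal" where
  "energy \<alpha> \<beta> \<mu> = ereal (1 / 2) *
     (enn2ereal (\<integral>\<^sup>+ (x, y). ennreal (kernel \<alpha> \<beta> x y) \<partial>(\<mu> \<Otimes>\<^sub>M \<mu>))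
      - enn2ereal (\<integral>\<^sup>+ (x, y). ennreal (- kernel \<alpha> \<beta> x y) \<partial>(\<mu> \<Otimes>\<^sub>M \<mu>)))"

definition energy_minimizers :: "real \<Rightarrow> real \<Rightarrow> 'a::euclidean_space measure set" where
  "energy_minimizers \<alpha> \<beta> =
     {\<mu> \<in> prob_measures. \<forall>\<nu> \<in> (prob_measures :: 'a measure set). energy \<alpha> \<beta> \<mu> \<le> energy \<alpha> \<beta> \<nu>}"

text \<open>The push-forward along the identity turns the uniform measure on the finite set \<open>S\<close>
  (with the power set of \<open>S\<close> as \<open>\<sigma>\<close>-algebra) into a Borel measure on the whole space.\<close>

definition regular_unit_simplex :: "'a::euclidean_space measure \<Rightarrow> bool" where
  "regular_unit_simplex \<mu> \<longleftrightarrow>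
     (\<exists>S. finite S \<and> card S = DIM('a) + 1 \<and>
          (\<forall>x\<in>S. \<forall>y\<in>S. x \<noteq> y \<longrightarrow> dist x y = 1) \<and>
          \<mu> = distr (uniform_count_measure S) borel (\<lambda>x. x))"

text \<open>The energy is invariant under translations, so minimizers are determined at best up to
  translation, and a sequence of minimizers can drift off to infinity. Weak compactness
  holds after translating each measure so that its center of mass is the origin. Every
  minimizer below has finite energy, hence a finite \<open>\<alpha>\<close>-th moment and a well-defined center
  of mass. A measure with center of mass \<open>0\<close> is left unchanged.\<close>

definition centered :: "'a::euclidean_space measure \<Rightarrow> 'a measure" where
  "centered \<mu> = distr \<mu> borel (\<lambda>x. x - (\<integral>y. y \<partial>\<mu>))"

end

theory Submission
  imports Defs
begin

text \<open>
Write \<open>n\<close> for the dimension and \<open>\<kappa> = 1 / 2 - 1 / \<alpha>\<close>. The limit functional is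
\<open>J \<mu> = \<integral>\<integral> |x - y| powr \<alpha> / \<alpha> - |x - y|\<^sup>2 / 2\<close> (\<open>limit_energy\<close>). A unit simplex has
\<open>J = - \<kappa> n / (n + 1)\<close>, because two independent points of it are at distance 1 with probability
\<open>n / (n + 1)\<close> and coincide otherwise. Young's inequality \<open>r powr b / b \<le> r\<^sup>2 / 2 + (1 / b - 1 / 2)\<close>
bounds the kernel for \<open>b < 2\<close> from below by the limit kernel up to a constant that vanishes as
\<open>b \<rightarrow> 2\<close>. Testing minimality against a simplex thus gives
\<open>J (\<mu> m) \<le> - \<kappa> n / (n + 1) + o(1)\<close> (\<open>energy_minimizer_properties\<close>), and what
remains is the stability of the simplex as a minimizer of \<open>J\<close>.

The first half of this is that \<open>|x - y|\<close> is close to 0 or to 1 with probability tending to 1. The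
kernel \<open>r powr \<alpha> / \<alpha> - r\<^sup>2 / 2\<close> dominates the multiple of \<open>r powr q - (q / 2) r\<^sup>2\<close> that agrees
with it at \<open>r = 0\<close> and touches it at \<open>r = 1\<close>, if \<open>2 < q \<le> \<alpha>\<close>; for \<open>q < \<alpha>\<close> these are the only
contact points. For \<open>q = 4\<close> the smaller kernel is a polynomial in the coordinates, its average is an
expression in the moments of \<open>\<mu>\<close>, and Cauchy-Schwarz bounds that below by the value of a simplex.
Hence for \<open>\<alpha> > 4\<close> the average of the gap tends to 0, and Markov's inequality applies
(\<open>off_simplex_small_of_quartic_growth\<close>). In dimension one \<open>q = 3\<close> is available, but for \<open>\<alpha> = 3\<close> there
is no gap, so the cubic functional itself has to be rigid. With \<open>h t = E |X - t|\<close> both of its terms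
are integrals over \<open>t\<close>, of \<open>h\<^sup>2 - t\<^sup>2\<close> and of \<open>h - |t|\<close>, and completing the square shows that near
the minimum \<open>h\<close> is almost \<open>1 / 2\<close> on \<open>[-1/2, 1/2]\<close>, which forces \<open>|X|\<close> to be almost \<open>1 / 2\<close>
(\<open>off_simplex_small_of_cubic_growth\<close>).

The second half is geometric. Choose a maximal set of typical points with mutual distances close
to 1. It has at most \<open>n + 1\<close> elements by a Gram matrix argument, and by maximality small balls around
its points carry almost all the mass. The bound on \<open>J\<close> also says that two independent points are
close to each other with probability at most \<open>1 / (n + 1) + o(1)\<close>. This probability is at least the
sum of the squared masses of the balls, so there are exactly \<open>n + 1\<close> balls and their masses are almost
equal (\<open>exists_clusters\<close>). Since the measures are centered and have bounded first moments, the
centers stay bounded; a convergent subsequence of the tuples of centers yields the limit simplex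
(\<open>weak_limit_is_unit_simplex\<close>).
\<close>

section \<open>Regular simplices and almost equilateral sets\<close>

text \<open>The scaled unit vectors \<open>e\<^sub>i / sqrt 2\<close> have mutual distance 1. The remaining vertex lies on the
diagonal, at \<open>(c, \<dots>, c)\<close>, where \<open>c\<close> solves \<open>n c\<^sup>2 - sqrt 2 c + 1 / 2 = 1\<close>.\<close>

lemma exists_unit_simplex:
  "\<exists>S :: (real ^ 'n) set. finite S \<and> card S = CARD('n) + 1 \<and> (\<forall>x\<in>S. \<forall>y\<in>S. x \<noteq> y \<longrightarrow> dist x y = 1)"
proof -
  define n where "n = real CARD('n)"
  have n: "n \<ge> 1" unfolding n_def by simp
  define c where "c = (sqrt 2 + sqrt (2 + 2 * n)) / (2 * n)"
  define a where "a = 1 / sqrt (2::real)"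
  have aa: "a * a = 1/2" by (simp add: a_def field_simps)
  have s2: "sqrt 2 * a = 1" by (simp add: a_def)
  define s where "s = sqrt (2 + 2*n)"
  have ss: "s * s = 2 + 2 * n" using n by (simp add: s_def)
  have c: "n * (c * c) - 2 * (c * a) = 1/2"
  proof -
    have ca: "c * a = (1 + s * a) / (2 * n)"
      unfolding c_def s_def[symmetric] using s2 by (simp add: field_simps)
    have "(sqrt 2 + s) * (sqrt 2 + s) = 2 + 2 * sqrt 2 * s + s * s"
      by (simp add: algebra_simps)
    moreover have "sqrt 2 = 2 * a" using aa s2 by (simp add: a_def real_div_sqrt)
    ultimately have "(sqrt 2 + s) * (sqrt 2 + s) = 4 + 4 * (s * a) + 2 * n" using ss by simp
    hence "n * (c * c) = (4 + 4 * (s * a) + 2 * n) / (4 * n)"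
      unfolding c_def s_def[symmetric] using n by (simp add: field_simps)
    thus ?thesis unfolding ca using n by (simp add: field_simps)
  qed
  define p :: "'n option \<Rightarrow> real ^ 'n" where
    "p = case_option (\<chi> i. c) (\<lambda>i. axis i a)"
  have d1: "dist (axis i a) (axis j a :: real^'n) = 1" if "i \<noteq> j" for i j
    using that unfolding dist_norm norm_eq_1
    by (simp add: inner_diff_left inner_diff_right inner_axis_axis aa)
  have d2: "dist (\<chi> i. c) (axis j a :: real^'n) = 1" for j
  proof -
    have "(\<chi> i::'n. c) \<bullet> (\<chi> i. c) = n * (c * c)" by (simp add: inner_vec_def n_def)
    moreover have "(\<chi> i::'n. c) \<bullet> axis j a = c * a" by (simp add: inner_axis)
    moreover have "axis j a \<bullet> (\<chi> i::'n. c) = c * a" by (subst inner_commute) (simp add: inner_axis)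
    moreover have "axis j a \<bullet> (axis j a :: real^'n) = 1/2" by (simp add: inner_axis_axis aa)
    ultimately show ?thesis unfolding dist_norm norm_eq_1 inner_diff_left inner_diff_right using c
      by linarith
  qed
  have dp: "dist (p u) (p v) = 1" if "u \<noteq> v" for u v
    using that d1 d2 by (cases u; cases v; auto simp: p_def dist_commute)
  have inj: "inj p"
    by (rule injI) (metis dist_self dp zero_neq_one)
  have "card (range p) = CARD('n) + 1"
    using card_image[OF inj] by (simp add: card_UNIV_option)
  moreover have "\<forall>x\<in>range p. \<forall>y\<in>range p. x \<noteq> y \<longrightarrow> dist x y = 1" by (auto intro!: dp)
  moreover have "finite (range p)" by simp
  ultimately show ?thesis by blast
qed

text \<open>By polarization, the Gram matrix of the edge vectors that leave a vertex \<open>z\<close> of an almost equilateral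
set is close to the matrix with 1 on and \<open>1 / 2\<close> off the diagonal.\<close>

lemma Gram_entries_of_almost_equilateral:
  fixes x y z :: "'a::real_inner"
  assumes e: "0 \<le> e" "e \<le> 1"
    and xz: "\<bar>dist x z - 1\<bar> \<le> e" and yz: "\<bar>dist y z - 1\<bar> \<le> e" and xy: "x \<noteq> y \<Longrightarrow> \<bar>dist x y - 1\<bar> \<le> e"
  shows "\<bar>(x - z) \<bullet> (y - z) - (if x = y then 1 else 1/2)\<bar> \<le> 5 * e"
proof -
  have sq: "\<bar>d\<^sup>2 - 1\<bar> \<le> 3 * e" if "\<bar>d - 1\<bar> \<le> e" for d :: real
  proof -
    have "\<bar>d\<^sup>2 - 1\<bar> = \<bar>d - 1\<bar> * \<bar>d + 1\<bar>" by (simp add: abs_mult[symmetric] power2_eq_square algebra_simps)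
    also have "\<dots> \<le> e * 3" using that e by (intro mult_mono) auto
    finally show ?thesis by simp
  qed
  have "(x - z) \<bullet> (y - z) = ((dist x z)\<^sup>2 + (dist y z)\<^sup>2 - (dist x y)\<^sup>2) / 2"
    unfolding dist_norm power2_norm_eq_inner by (simp add: inner_diff inner_commute algebra_simps)
  moreover have "x \<noteq> y \<Longrightarrow> \<bar>(dist x y)\<^sup>2 - 1\<bar> \<le> 3 * e" using sq xy by blast
  ultimately show ?thesis using sq[OF xz] sq[OF yz] e by (cases "x = y") auto
qed

text \<open>Among \<open>n + 2\<close> points, the \<open>n + 1\<close> edge vectors leaving one of them are linearly dependent, so their
Gram matrix is singular. But that matrix is a small perturbation of \<open>(I + 1 1\<^sup>T) / 2\<close>, whose quadratic
form is at least \<open>|u|\<^sup>2 / 2\<close>.\<close>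

lemma card_almost_equilateral_le:
  fixes C :: "'a::euclidean_space set" and e :: real
  assumes fin: "finite C" and e: "0 \<le> e" "10 * e * (DIM('a) + 1) < 1"
    and C: "\<And>x y. x \<in> C \<Longrightarrow> y \<in> C \<Longrightarrow> x \<noteq> y \<Longrightarrow> \<bar>dist x y - 1\<bar> \<le> e"
  shows "card C \<le> DIM('a) + 1"
proof (rule ccontr)
  assume "\<not> card C \<le> DIM('a) + 1"
  then have big: "DIM('a) + 2 \<le> card C" by simp
  then obtain D where D: "D \<subseteq> C" "card D = DIM('a) + 2" "finite D"
    by (metis obtain_subset_with_card_n finite_subset fin)
  then obtain z where z: "z \<in> D" by (metis card.empty add_is_0 all_not_in_conv zero_neq_numeral)
  define E where "E = D - {z}"
  define V where "V = (\<lambda>x. x - z) ` E"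
  have inj: "inj_on (\<lambda>x. x - z) E" by (auto simp: inj_on_def)
  have cE: "card E = DIM('a) + 1" "finite E" using D z by (auto simp: E_def)
  have "dependent V"
    by (rule dependent_biggerset) (use cE inj in \<open>auto simp: V_def card_image\<close>)
  moreover have "finite V" using cE by (simp add: V_def)
  ultimately obtain u0 where "\<exists>v\<in>V. u0 v \<noteq> 0" "(\<Sum>v\<in>V. u0 v *\<^sub>R v) = 0"
    using dependent_finite by blast
  then obtain u where u: "\<exists>x\<in>E. u x \<noteq> 0" and us: "(\<Sum>x\<in>E. u x *\<^sub>R (x - z)) = 0"
    unfolding V_def by (auto simp: sum.reindex[OF inj] comp_def)
  have "10 * e * 1 \<le> 10 * e * (DIM('a) + 1)" using e(1) by (intro mult_left_mono) auto
  then have "e \<le> 1" using e by linarith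
  have gram: "\<bar>(x - z) \<bullet> (y - z) - (if x = y then 1 else 1/2)\<bar> \<le> 5 * e" if "x \<in> E" "y \<in> E" for x y
    using that D z C e(1) \<open>e \<le> 1\<close> by (intro Gram_entries_of_almost_equilateral) (auto simp: E_def)
  define Q where "Q = (\<Sum>x\<in>E. (u x)\<^sup>2)"
  have Q: "Q > 0" unfolding Q_def using u cE by (auto intro!: sum_pos2 simp: )
  \<comment> \<open>The quadratic form of the Gram matrix vanishes at the coefficients of the linear relation.\<close>
  have "0 = (\<Sum>x\<in>E. u x *\<^sub>R (x - z)) \<bullet> (\<Sum>y\<in>E. u y *\<^sub>R (y - z))" using us by simp
  also have "\<dots> = (\<Sum>x\<in>E. \<Sum>y\<in>E. u x * u y * ((x - z) \<bullet> (y - z)))"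
    by (simp add: inner_sum_left inner_sum_right sum_distrib_left mult.assoc, intro sum.cong refl)
      (simp add: inner_commute)
  also have "\<dots> \<ge> (\<Sum>x\<in>E. \<Sum>y\<in>E. u x * u y * (if x = y then 1 else 1/2) - 5 * e * (((u x)\<^sup>2 + (u y)\<^sup>2) / 2))"
  proof (intro sum_mono)
    fix x y assume "x \<in> E" "y \<in> E"
    define d where "d = (x - z) \<bullet> (y - z) - (if x = y then 1 else 1/2)"
    have "\<bar>u x * u y * d\<bar> \<le> ((u x)\<^sup>2 + (u y)\<^sup>2) / 2 * (5 * e)"
      unfolding abs_mult[of _ d] using gram[OF \<open>x \<in> E\<close> \<open>y \<in> E\<close>] sum_squares_bound[of "\<bar>u x\<bar>" "\<bar>u y\<bar>"]
      by (intro mult_mono) (auto simp: d_def abs_mult)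
    also have "\<dots> = 5 * e * (((u x)\<^sup>2 + (u y)\<^sup>2) / 2)" by (simp add: mult.commute)
    finally have "- (5 * e * (((u x)\<^sup>2 + (u y)\<^sup>2) / 2)) \<le> u x * u y * d" by linarith
    moreover have "(x - z) \<bullet> (y - z) = (if x = y then 1 else 1/2) + d" by (simp add: d_def)
    ultimately show "u x * u y * (if x = y then 1 else 1/2) - 5 * e * (((u x)\<^sup>2 + (u y)\<^sup>2) / 2) \<le> u x * u y * ((x - z) \<bullet> (y - z))"
      by (simp only: distrib_left)
  qed
  also have "(\<Sum>x\<in>E. \<Sum>y\<in>E. u x * u y * (if x = y then 1 else 1/2) - 5 * e * (((u x)\<^sup>2 + (u y)\<^sup>2) / 2))
     = (Q + (\<Sum>x\<in>E. u x)\<^sup>2) / 2 - 5 * e * (DIM('a) + 1) * Q"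
  proof -
    have "(\<Sum>x\<in>E. \<Sum>y\<in>E. u x * u y * (if x = y then 1 else 1/2))
      = (\<Sum>x\<in>E. \<Sum>y\<in>E. (if x = y then (u x)\<^sup>2 / 2 else 0) + u x * u y / 2)"
      by (intro sum.cong) (auto simp: power2_eq_square)
    also have "\<dots> = (Q + (\<Sum>x\<in>E. u x)\<^sup>2) / 2"
    proof -
      have "(\<Sum>x\<in>E. \<Sum>y\<in>E. u x * u y / 2) = (\<Sum>x\<in>E. u x)\<^sup>2 / 2"
        unfolding power2_eq_square sum_product sum_divide_distrib ..
      moreover have "(\<Sum>x\<in>E. (u x)\<^sup>2 / 2) = Q / 2" by (simp add: Q_def sum_divide_distrib)
      ultimately show ?thesis using cE by (simp add: sum.distrib add_divide_distrib)
    qed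
    finally have 1: "(\<Sum>x\<in>E. \<Sum>y\<in>E. u x * u y * (if x = y then 1 else 1/2)) = (Q + (\<Sum>x\<in>E. u x)\<^sup>2) / 2" .
    have "(\<Sum>x\<in>E. \<Sum>y\<in>E. 5 * e * (((u x)\<^sup>2 + (u y)\<^sup>2) / 2)) = 5 * e * (DIM('a) + 1) * Q"
    proof -
      have "(\<Sum>x\<in>E. \<Sum>y\<in>E. 5 * e * (((u x)\<^sup>2 + (u y)\<^sup>2) / 2))
        = (\<Sum>x\<in>E. (5 * e / 2) * (\<Sum>y\<in>E. (u x)\<^sup>2 + (u y)\<^sup>2))"
        unfolding sum_distrib_left by simp
      also have "\<dots> = (5 * e / 2) * (\<Sum>x\<in>E. \<Sum>y\<in>E. (u x)\<^sup>2 + (u y)\<^sup>2)"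
        unfolding sum_distrib_left by simp
      also have "(\<Sum>x\<in>E. \<Sum>y\<in>E. (u x)\<^sup>2 + (u y)\<^sup>2) = 2 * (DIM('a) + 1) * Q"
        by (simp add: sum.distrib Q_def cE sum_distrib_left) (simp add: algebra_simps)
      also have "5 * e / 2 * (2 * (DIM('a) + 1) * Q) = 5 * e * (DIM('a) + 1) * Q" by simp
      finally show ?thesis .
    qed
    with 1 show ?thesis by (simp add: sum_subtractf)
  qed
  finally have "Q / 2 \<le> 5 * e * (DIM('a) + 1) * Q"
    using zero_le_power2[of "\<Sum>x\<in>E. u x"] unfolding add_divide_distrib by linarith
  moreover have "(5 * e * (DIM('a) + 1)) * Q < (1/2) * Q"
    using e Q by (intro mult_strict_right_mono) auto
  ultimately show False by simp
qed

section \<open>Clusters of a measure whose pairwise distances are nearly 0 or 1\<close>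

lemma prob_measures_iff: "M \<in> prob_measures \<longleftrightarrow> sets M = sets borel \<and> prob_space M"
  by (auto simp: space_prob_algebra)

lemma space_prob_measures: "M \<in> prob_measures \<Longrightarrow> space M = UNIV"
  by (metis prob_measures_iff sets_eq_imp_space_eq space_borel)

text \<open>The pairs whose distance is not within \<open>e\<close> of 0 or 1, the two distances that occur in a unit simplex.\<close>

abbreviation off_simplex :: "real \<Rightarrow> ('a::metric_space \<times> 'a) set" where
  "off_simplex e \<equiv> {z. e < dist (fst z) (snd z) \<and> e < \<bar>dist (fst z) (snd z) - 1\<bar>}"

lemma pair_sets_borel:
  fixes M :: "'a::euclidean_space measure"
  assumes "M \<in> prob_measures"
  shows "sets (M \<Otimes>\<^sub>M M) = sets (borel :: ('a \<times> 'a) measure)"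
  using assms by (metis borel_prod prob_measures_iff sets_pair_measure_cong)

lemma distance_event_measurable:
  fixes M :: "'a::euclidean_space measure"
  assumes "M \<in> prob_measures" "{r. P r} \<in> sets borel"
  shows "{z. P (dist (fst z) (snd z))} \<in> sets (M \<Otimes>\<^sub>M M)"
proof -
  have "(\<lambda>z::'a \<times> 'a. dist (fst z) (snd z)) \<in> borel_measurable borel"
    by (intro borel_measurable_continuous_onI continuous_intros)
  from measurable_sets[OF this assms(2)] show ?thesis
    unfolding pair_sets_borel[OF assms(1)] by (simp add: vimage_def)
qed

lemma off_simplex_sets:
  fixes M :: "'a::euclidean_space measure"
  assumes "M \<in> prob_measures"
  shows "off_simplex e \<in> sets (M \<Otimes>\<^sub>M M)"
  by (rule distance_event_measurable[OF assms]) (auto intro!: borel_open open_Collect_conj open_Collect_less continuous_intros)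

text \<open>Call a point typical if it forms an exceptional pair with few other points. A maximal almost
equilateral set \<open>C\<close> of typical points works: a typical point outside the balls around \<open>C\<close> that forms
no exceptional pair with \<open>C\<close> could be added to \<open>C\<close>.\<close>

lemma exists_cluster_centres:
  fixes M :: "'a::euclidean_space measure" and e :: real
  assumes M: "M \<in> prob_measures" and e: "0 < e" "10 * e * (DIM('a) + 1) < 1"
    and off: "measure (M \<Otimes>\<^sub>M M) (off_simplex e) \<le> e\<^sup>2"
  shows "\<exists>C. finite C \<and> card C \<le> DIM('a) + 1 \<and> (\<forall>x\<in>C. \<forall>y\<in>C. x \<noteq> y \<longrightarrow> \<bar>dist x y - 1\<bar> \<le> e)
     \<and> 1 - (DIM('a) + 2) * e \<le> measure M (\<Union>c\<in>C. cball c e)"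
proof -
  interpret prob_space M using M by (simp add: prob_measures_iff)
  interpret P: pair_prob_space M M ..
  have sM[measurable_cong]: "sets M = sets borel" and UM: "space M = UNIV"
    using M by (auto simp: prob_measures_iff space_prob_measures)
  \<comment> \<open>The probability that a random second point is exceptional for \<open>x\<close>.\<close>
  define b where "b x = measure M (Pair x -` off_simplex e)" for x
  have sec: "Pair x -` off_simplex e \<in> sets M" for x
    using sets_Pair1[OF off_simplex_sets[OF M]] by simp
  have bint: "integrable M b" and bI: "(\<integral>x. b x \<partial>M) \<le> e\<^sup>2"
  proof -
    let ?f = "\<lambda>z. indicator (off_simplex e) z :: real"
    have i: "integrable (M \<Otimes>\<^sub>M M) ?f" 
      by (rule P.integrable_const_bound[of _ 1]) (use off_simplex_sets[OF M, of e] in auto)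
    have b: "(\<integral>y. ?f (x, y) \<partial>M) = b x" for x
    proof -
      have "(\<integral>y. ?f (x, y) \<partial>M) = (\<integral>y. indicator (Pair x -` off_simplex e) y \<partial>M)"
        by (intro Bochner_Integration.integral_cong) (auto simp: indicator_def)
      also have "\<dots> = b x" unfolding b_def using sec by simp
      finally show ?thesis .
    qed
    show "integrable M b" using P.integrable_fst'[OF i] unfolding b .
    have "(\<integral>x. b x \<partial>M) = integral\<^sup>L (M \<Otimes>\<^sub>M M) ?f" using P.integral_fst'[OF i] unfolding b .
    also have "\<dots> = measure (M \<Otimes>\<^sub>M M) (off_simplex e)" using off_simplex_sets[OF M] by simp
    finally show "(\<integral>x. b x \<partial>M) \<le> e\<^sup>2" using off by simp
  qed
  define G where "G = {x. b x < e}"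
  have [measurable]: "b \<in> borel_measurable M" using bint by simp
  have Gs: "G \<in> sets M" 
  proof -
    have "{x \<in> space M. b x < e} \<in> sets M" by measurable
    then show ?thesis by (simp add: G_def UM)
  qed
  have "measure M {x \<in> space M. b x \<ge> e} \<le> (\<integral>x. b x \<partial>M) / e"
    by (rule integral_Markov_inequality_measure[OF bint sets.empty_sets _ e(1)]) (simp add: b_def)
  also have "\<dots> \<le> e" using bI e by (simp add: power2_eq_square divide_le_eq)
  finally have "measure M (space M - G) \<le> e"
    by (simp add: G_def UM not_less set_diff_eq)
  then have G: "1 - e \<le> measure M G" using prob_compl[OF Gs] by simp
  define Ok where "Ok C \<longleftrightarrow> finite C \<and> C \<subseteq> G \<and> (\<forall>x\<in>C. \<forall>y\<in>C. x \<noteq> y \<longrightarrow> \<bar>dist x y - 1\<bar> \<le> e)" for C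
  have bound: "card C \<le> DIM('a) + 1" if "Ok C" for C
    using that e card_almost_equilateral_le[of C e] by (auto simp: Ok_def)
  have "Ok {}" by (simp add: Ok_def)
  moreover have "\<forall>C. Ok C \<longrightarrow> card C < DIM('a) + 2" using bound by fastforce
  ultimately have "\<exists>C. Ok C \<and> (\<forall>D. Ok D \<longrightarrow> card D \<le> card C)"
    by (rule ex_has_greatest_nat)
  then obtain C where C: "Ok C" "\<And>D. Ok D \<Longrightarrow> card D \<le> card C" by blast
  have fin: "finite C" using C by (simp add: Ok_def)
  have cov: "G \<subseteq> (\<Union>c\<in>C. cball c e) \<union> (\<Union>c\<in>C. Pair c -` off_simplex e)"
  proof
    fix y assume y: "y \<in> G"
    show "y \<in> (\<Union>c\<in>C. cball c e) \<union> (\<Union>c\<in>C. Pair c -` off_simplex e)"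
    proof (cases "y \<in> C")
      case True then have "y \<in> (\<Union>c\<in>C. cball c e)" using e by (intro UN_I[of y]) auto
      then show ?thesis ..
    next
      case False
      have "Ok (insert y C)" if "\<forall>c\<in>C. \<bar>dist c y - 1\<bar> \<le> e"
        using that C(1) y unfolding Ok_def by (simp add: dist_commute)
      moreover have "\<not> Ok (insert y C)" using C(2)[of "insert y C"] False fin by fastforce
      ultimately obtain c where c: "c \<in> C" "\<not> \<bar>dist c y - 1\<bar> \<le> e" by meson
      show ?thesis
      proof (cases "dist c y \<le> e")
        case True
        then have "y \<in> cball c e" by simp
        then show ?thesis by (rule UnI1[OF UN_I[OF c(1)]])
      next
        case False
        then have "y \<in> Pair c -` off_simplex e" using c(2) by simp
        then show ?thesis by (rule UnI2[OF UN_I[OF c(1)]])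
      qed
    qed
  qed
  have ball_s: "(\<Union>c\<in>C. cball c e) \<in> sets M" using fin by (rule sets.finite_UN) (simp add: sM)
  have off_s: "(\<Union>c\<in>C. Pair c -` off_simplex e) \<in> sets M" using fin sec by (rule sets.finite_UN)
  have "measure M G \<le> measure M ((\<Union>c\<in>C. cball c e) \<union> (\<Union>c\<in>C. Pair c -` off_simplex e))"
    using cov by (rule finite_measure_mono) (rule sets.Un[OF ball_s off_s])
  also have "\<dots> \<le> measure M (\<Union>c\<in>C. cball c e) + measure M (\<Union>c\<in>C. Pair c -` off_simplex e)"
    by (rule measure_Un_le[OF ball_s off_s])
  also have "measure M (\<Union>c\<in>C. Pair c -` off_simplex e) \<le> (\<Sum>c\<in>C. b c)"
    unfolding b_def using sec fin by (intro finite_measure_subadditive_finite) auto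
  also have "(\<Sum>c\<in>C. b c) \<le> (\<Sum>c\<in>C. e)"
    using C(1) unfolding Ok_def G_def by (intro sum_mono) (auto intro: less_imp_le)
  also have "\<dots> \<le> (DIM('a) + 1) * e"
    using bound[OF C(1)] e by (simp add: mult_right_mono)
  finally have "1 - (DIM('a) + 2) * e \<le> measure M (\<Union>c\<in>C. cball c e)"
    using G by (simp add: algebra_simps)
  then show ?thesis using C(1) bound[OF C(1)] by (auto simp: Ok_def)
qed

text \<open>The squared masses of the disjoint balls add up to at most the probability that two independent
points are close, which is about \<open>1 / N\<close>, while the masses add up to almost 1. The last term on the
right penalizes having fewer than \<open>N\<close> balls.\<close>

lemma cluster_masses_almost_uniform:
  fixes M :: "'a::euclidean_space measure" and N :: nat
  assumes M: "M \<in> prob_measures" and e: "0 < e" "e < 1/3" and N: "N > 0"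
    and C: "finite C" "card C \<le> N" "\<And>x y. x \<in> C \<Longrightarrow> y \<in> C \<Longrightarrow> x \<noteq> y \<Longrightarrow> \<bar>dist x y - 1\<bar> \<le> e"
    and W: "1 - w \<le> measure M (\<Union>c\<in>C. cball c e)"
    and near: "measure (M \<Otimes>\<^sub>M M) {z. dist (fst z) (snd z) \<le> 2 * e} \<le> 1 / N + d"
  shows "(\<Sum>c\<in>C. (measure M (cball c e) - 1 / N)\<^sup>2) \<le> d + 2 * w - (N - card C) / N\<^sup>2"
proof -
  interpret prob_space M using M by (simp add: prob_measures_iff)
  interpret P: pair_prob_space M M ..
  have sM: "sets M = sets borel" using M by (auto simp: prob_measures_iff)
  define m where "m c = measure M (cball c e)" for c
  have disj: "disjoint_family_on (\<lambda>c. cball c e) C"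
    unfolding disjoint_family_on_def
  proof (intro ballI impI)
    fix x y assume xy: "x \<in> C" "y \<in> C" "x \<noteq> y"
    have False if "z \<in> cball x e" "z \<in> cball y e" for z
      using that C(3)[OF xy] dist_triangle2[of x y z] e by (auto simp: dist_commute)
    then show "cball x e \<inter> cball y e = {}" by blast
  qed
  have s: "cball c e \<in> sets M" for c using sM by simp
  have sum: "(\<Sum>c\<in>C. m c) = measure M (\<Union>c\<in>C. cball c e)"
    unfolding m_def using s disj C(1) by (intro finite_measure_finite_Union[symmetric]) auto
  have "(\<Sum>c\<in>C. (m c)\<^sup>2) = (\<Sum>c\<in>C. measure (M \<Otimes>\<^sub>M M) (cball c e \<times> cball c e))"
    unfolding m_def using s by (simp add: power2_eq_square measure_def emeasure_pair_measure_Times enn2real_mult)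
  also have "\<dots> = measure (M \<Otimes>\<^sub>M M) (\<Union>c\<in>C. cball c e \<times> cball c e)"
    using s disj C(1) by (intro P.finite_measure_finite_Union[symmetric]) (auto simp: disjoint_family_on_def)
  also have "\<dots> \<le> measure (M \<Otimes>\<^sub>M M) {z. dist (fst z) (snd z) \<le> 2 * e}"
  proof (rule P.finite_measure_mono)
    show "(\<Union>c\<in>C. cball c e \<times> cball c e) \<subseteq> {z. dist (fst z) (snd z) \<le> 2 * e}"
    proof clarsimp
      fix c x y assume "dist c x \<le> e" "dist c y \<le> e"
      then show "dist x y \<le> 2 * e" using dist_triangle3[of x y c] by simp
    qed
    show "{z. dist (fst z) (snd z) \<le> 2 * e} \<in> sets (M \<Otimes>\<^sub>M M)"
      by (rule distance_event_measurable[OF M]) simp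
  qed
  finally have sq: "(\<Sum>c\<in>C. (m c)\<^sup>2) \<le> 1 / N + d" using near by simp
  have "(\<Sum>c\<in>C. (m c - 1 / N)\<^sup>2) = (\<Sum>c\<in>C. (m c)\<^sup>2 - 2 / N * m c + 1 / N\<^sup>2)"
    by (intro sum.cong) (auto simp: power2_diff power_divide)
  also have "\<dots> = (\<Sum>c\<in>C. (m c)\<^sup>2) - 2 / N * (\<Sum>c\<in>C. m c) + card C / N\<^sup>2"
    by (simp add: sum.distrib sum_subtractf sum_distrib_left)
  also have "\<dots> \<le> (1 / N + d) - 2 / N * (1 - w) + card C / N\<^sup>2"
    using W sq unfolding sum by (intro add_mono diff_mono mult_left_mono) auto
  also have "\<dots> = d + 2 / N * w - (N - card C) / N\<^sup>2"
    using N C(2) by (simp add: of_nat_diff power2_eq_square field_simps)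
  also have "\<dots> \<le> d + 2 * w - (N - card C) / N\<^sup>2"
  proof -
    have "0 \<le> w" using W prob_le_1[of "\<Union>c\<in>C. cball c e"] by linarith
    then have "2 / N * w \<le> 2 * w" using N by (intro mult_right_mono) (auto simp: divide_le_eq)
    then show ?thesis by simp
  qed
  finally show ?thesis unfolding m_def .
qed

text \<open>The \<open>n + 1\<close> centers are a vector indexed by \<open>'n option\<close>, so that the tuple of centers lives in
a single Euclidean space.\<close>

definition clustered_at :: "real \<Rightarrow> (real ^ 'n) measure \<Rightarrow> (real ^ 'n) ^ 'n option \<Rightarrow> real \<Rightarrow> bool" where
  "clustered_at \<epsilon> M p r \<longleftrightarrow> 0 < r \<and> r \<le> \<epsilon> \<and>
     (\<forall>i j. i \<noteq> j \<longrightarrow> \<bar>dist (p $ i) (p $ j) - 1\<bar> \<le> r) \<and>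
     (\<forall>i. \<bar>measure M (cball (p $ i) r) - 1 / (CARD('n) + 1)\<bar> \<le> \<epsilon>)"

text \<open>If there were fewer than \<open>n + 1\<close> balls, then \<open>cluster_masses_almost_uniform\<close> would bound a sum
of squares by a negative number; with \<open>n + 1\<close> balls it bounds the deviation of each mass from
\<open>1 / (n + 1)\<close>.\<close>

lemma exists_clusters:
  fixes M :: "(real ^ 'n) measure" and N :: real
  defines "N \<equiv> CARD('n) + 1"
  assumes M: "M \<in> prob_measures" and e: "0 < e" "10 * e * N < 1"
    and off: "measure (M \<Otimes>\<^sub>M M) (off_simplex e) \<le> e\<^sup>2"
    and near: "measure (M \<Otimes>\<^sub>M M) {z. dist (fst z) (snd z) \<le> 2 * e} \<le> 1 / N + d"
    and \<epsilon>: "e \<le> \<epsilon>" "d + 2 * ((N + 1) * e) \<le> \<epsilon>\<^sup>2" "d + 2 * ((N + 1) * e) < 1 / N\<^sup>2"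
  shows "\<exists>p. clustered_at \<epsilon> M p e"
proof -
  define N' where "N' = CARD('n) + 1"
  have N': "N = real N'" "DIM(real^'n) + 1 = N'" "N' > 0" by (auto simp: N_def N'_def)
  have N1: "N \<ge> 2" unfolding N_def by (simp add: Suc_leI)
  have "10 * e * 2 \<le> 10 * e * N" using N1 e(1) by (intro mult_left_mono) auto
  then have e3: "e < 1/3" using e(2) by linarith
  obtain C where C: "finite C" "card C \<le> N'" "\<And>x y. x \<in> C \<Longrightarrow> y \<in> C \<Longrightarrow> x \<noteq> y \<Longrightarrow> \<bar>dist x y - 1\<bar> \<le> e"
    "1 - (N + 1) * e \<le> measure M (\<Union>c\<in>C. cball c e)"
    using exists_cluster_centres[OF M e(1) _ off] e(2) unfolding N_def N'_def by (auto simp: add.assoc)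
  have *: "(\<Sum>c\<in>C. (measure M (cball c e) - 1 / N)\<^sup>2) \<le> d + 2 * ((N + 1) * e) - (N' - card C) / N\<^sup>2"
    using cluster_masses_almost_uniform[OF M e(1) e3 N'(3) C(1-3,4) near[unfolded N'(1)]] by (simp add: N'(1))
  have card: "card C = N'"
  proof (rule ccontr)
    assume "card C \<noteq> N'"
    then have "1 / N\<^sup>2 \<le> real (N' - card C) / N\<^sup>2" using C(2) by (intro divide_right_mono) auto
    then show False using * \<epsilon>(3) sum_nonneg[of C "\<lambda>c. (measure M (cball c e) - 1 / N)\<^sup>2"] by simp
  qed
  have mass: "\<bar>measure M (cball c e) - 1 / N\<bar> \<le> \<epsilon>" if "c \<in> C" for c
  proof (rule abs_le_square_iff[THEN iffD2, of _ \<epsilon>, simplified abs_of_pos[OF order_less_le_trans[OF e(1) \<epsilon>(1)]]])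
    have "(measure M (cball c e) - 1 / N)\<^sup>2 \<le> (\<Sum>c\<in>C. (measure M (cball c e) - 1 / N)\<^sup>2)"
      using that C(1) by (intro member_le_sum) auto
    also have "\<dots> \<le> \<epsilon>\<^sup>2" using * \<epsilon>(2) card by simp
    finally show "(measure M (cball c e) - 1 / N)\<^sup>2 \<le> \<epsilon>\<^sup>2" .
  qed
  have "card (UNIV :: 'n option set) = card C" by (simp add: card N'_def card_UNIV_option)
  then obtain h :: "'n option \<Rightarrow> real^'n" where h: "bij_betw h UNIV C"
    using finite_same_card_bij[OF finite C(1)] by blast
  have hC: "h i \<in> C" for i using h by (auto simp: bij_betw_def)
  have inj: "h i \<noteq> h j" if "i \<noteq> j" for i j
    using h that by (auto simp: bij_betw_def inj_on_def)
  have d: "\<bar>dist (h i) (h j) - 1\<bar> \<le> e" if "i \<noteq> j" for i j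
    by (rule C(3)[OF hC hC inj[OF that]])
  have "clustered_at \<epsilon> M (\<chi> i. h i) e"
    unfolding clustered_at_def
  proof (intro conjI allI impI)
    fix i j :: "'n option"
    show "\<bar>measure M (cball ((\<chi> i. h i) $ i) e) - 1 / real (CARD('n) + 1)\<bar> \<le> \<epsilon>"
      using mass[OF hC[of i]] by (simp add: N_def)
    show "\<bar>dist ((\<chi> i. h i) $ i) ((\<chi> i. h i) $ j) - 1\<bar> \<le> e" if "i \<noteq> j"
      unfolding vec_lambda_beta by (rule d[OF that])
  qed (rule e(1), rule \<epsilon>(1))
  then show ?thesis by (rule exI)
qed

lemma disjoint_cluster_balls:
  assumes "clustered_at \<epsilon> M p r" "\<epsilon> \<le> 1/4"
  shows "disjoint_family_on (\<lambda>i. cball (p $ i) r) UNIV"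
  unfolding disjoint_family_on_def
proof (intro ballI impI)
  fix i j :: "'a option" assume "i \<noteq> j"
  then have d: "\<bar>dist (p $ i) (p $ j) - 1\<bar> \<le> r" "r \<le> 1/4"
    using assms unfolding clustered_at_def by auto
  have False if "z \<in> cball (p $ i) r" "z \<in> cball (p $ j) r" for z
    using that d dist_triangle2[of "p $ i" "p $ j" z] by (auto simp: dist_commute)
  then show "cball (p $ i) r \<inter> cball (p $ j) r = {}" by blast
qed

section \<open>Weak convergence of clustered measures\<close>

lemma integral_close_to_cluster_average:
  fixes M :: "(real ^ 'n) measure" and f :: "real ^ 'n \<Rightarrow> real" and \<epsilon> \<eta> B :: real
  assumes M: "M \<in> prob_measures" and cl: "clustered_at \<epsilon> M p r" "\<epsilon> \<le> 1/4"
    and f: "continuous_on UNIV f" "\<And>x. \<bar>f x\<bar> \<le> B"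
    and near: "\<And>i x. dist (p $ i) x \<le> r \<Longrightarrow> \<bar>f x - c i\<bar> \<le> \<eta>"
    and c: "\<And>i. \<bar>c i\<bar> \<le> B"
  shows "\<bar>(\<integral>x. f x \<partial>M) - (\<Sum>i\<in>UNIV. c i / (CARD('n) + 1))\<bar> \<le> \<eta> + 2 * real (CARD('n) + 1) * B * \<epsilon>"
proof -
  interpret prob_space M using M by (simp add: prob_measures_iff)
  have sM[measurable_cong]: "sets M = sets borel" using M by (auto simp: prob_measures_iff)
  define N where "N = real (CARD('n) + 1)"
  define U where "U i = cball (p $ i) r" for i
  have Us[measurable]: "U i \<in> sets M" for i by (simp add: sM U_def)
  have UNs: "(\<Union>i. U i) \<in> sets M" by (rule sets.finite_UN) (simp_all add: Us)
  have disj: "disjoint_family_on U UNIV" unfolding U_def by (rule disjoint_cluster_balls[OF cl])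
  have m: "\<bar>measure M (U i) - 1 / N\<bar> \<le> \<epsilon>" for i using cl unfolding clustered_at_def U_def N_def by simp
  have cN: "(\<Sum>i\<in>(UNIV :: 'n option set). x) = N * x" for x :: real by (simp add: N_def card_UNIV_option)
  have "measure M (\<Union>i. U i) = (\<Sum>i\<in>UNIV. measure M (U i))"
    by (rule finite_measure_finite_Union) (use disj Us in auto)
  also have "\<dots> \<ge> (\<Sum>i\<in>(UNIV :: 'n option set). 1 / N - \<epsilon>)"
    using m by (intro sum_mono) (smt (verit))
  also have "(\<Sum>i\<in>(UNIV :: 'n option set). 1 / N - \<epsilon>) = 1 - N * \<epsilon>" unfolding cN by (simp add: N_def right_diff_distrib)
  finally have out: "measure M (space M - (\<Union>i. U i)) \<le> N * \<epsilon>" using prob_compl[OF UNs] by simp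
  have \<eta>: "0 \<le> \<eta>" using near[of undefined "p $ undefined"] cl(1) unfolding clustered_at_def by fastforce
  have B: "0 \<le> B" using c[of undefined] by linarith
  have \<epsilon>: "0 \<le> \<epsilon>" using cl(1) unfolding clustered_at_def by linarith
  have fm[measurable]: "f \<in> borel_measurable M"
    using borel_measurable_continuous_onI[OF f(1)] measurable_cong_sets[OF sM refl] by blast
  have fint: "integrable M f" using f(2) by (intro integrable_const_bound[of _ B]) auto
  define g where "g x = (\<Sum>i\<in>UNIV. indicator (U i) x * c i)" for x
  have gint: "integrable M g" unfolding g_def
    by (intro Bochner_Integration.integrable_sum integrable_mult_left integrable_real_indicator) (auto simp: emeasure_finite less_top[symmetric])
  have gI: "(\<integral>x. g x \<partial>M) = (\<Sum>i\<in>UNIV. measure M (U i) * c i)"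
    unfolding g_def
    by (subst Bochner_Integration.integral_sum)
       (auto intro!: integrable_mult_left integrable_real_indicator simp: emeasure_finite less_top[symmetric])
  have pt: "\<bar>f x - g x\<bar> \<le> \<eta> + B * indicator (space M - (\<Union>i. U i)) x" if x: "x \<in> space M" for x
  proof (cases "x \<in> (\<Union>i. U i)")
    case True
    then obtain i where i: "x \<in> U i" by blast
    have "indicator (U j) x = (if j = i then 1 else 0 :: real)" for j
      using disj i unfolding disjoint_family_on_def by (auto simp: indicator_def)
    then have "g x = c i" unfolding g_def by (simp add: if_distrib[of "\<lambda>t. t * _"] cong: if_cong)
    then show ?thesis using near[of i x] i B by (simp add: U_def indicator_def)
  next
    case False
    then have "g x = 0" by (auto simp: g_def indicator_def)
    then show ?thesis using False x f(2)[of x] \<eta> by (auto simp: indicator_def)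
  qed
  have "\<bar>(\<integral>x. f x \<partial>M) - (\<integral>x. g x \<partial>M)\<bar> = \<bar>\<integral>x. f x - g x \<partial>M\<bar>" using fint gint by simp
  also have "\<dots> \<le> (\<integral>x. \<bar>f x - g x\<bar> \<partial>M)" by (rule integral_abs_bound)
  also have "\<dots> \<le> (\<integral>x. \<eta> + B * indicator (space M - (\<Union>i. U i)) x \<partial>M)"
    using pt fint gint UNs
    by (intro integral_mono) (auto intro!: integrable_real_indicator simp: emeasure_finite less_top[symmetric])
  also have "\<dots> = \<eta> + B * measure M (space M - (\<Union>i. U i))"
    using UNs by (subst Bochner_Integration.integral_add)
       (auto intro!: integrable_real_indicator simp: emeasure_finite less_top[symmetric] prob_space Int_absorb2)
  also have "\<dots> \<le> \<eta> + B * (N * \<epsilon>)" using out B by (intro add_left_mono mult_left_mono) auto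
  finally have 1: "\<bar>(\<integral>x. f x \<partial>M) - (\<Sum>i\<in>UNIV. measure M (U i) * c i)\<bar> \<le> \<eta> + B * (N * \<epsilon>)" unfolding gI .
  have "\<bar>(\<Sum>i\<in>UNIV. measure M (U i) * c i) - (\<Sum>i\<in>UNIV. c i / N)\<bar> = \<bar>\<Sum>i\<in>UNIV. (measure M (U i) - 1 / N) * c i\<bar>"
    by (simp add: sum_subtractf[symmetric] left_diff_distrib)
  also have "\<dots> \<le> (\<Sum>i\<in>UNIV. \<bar>(measure M (U i) - 1 / N) * c i\<bar>)" by (rule sum_abs)
  also have "\<dots> \<le> (\<Sum>i\<in>(UNIV :: 'n option set). \<epsilon> * B)"
    unfolding abs_mult using m c \<epsilon> by (intro sum_mono mult_mono) auto
  also have "\<dots> = N * (\<epsilon> * B)" by (rule cN)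
  finally show ?thesis using 1 unfolding N_def[symmetric] by (simp add: algebra_simps)
qed

text \<open>The ball around each center carries a fixed share of the mass, so a far center would make the first
moment large.\<close>

lemma cluster_centre_bound:
  fixes M :: "(real ^ 'n) measure" and B :: real
  assumes M: "M \<in> prob_measures" and cl: "clustered_at \<epsilon> M p r" "\<epsilon> \<le> 1 / (2 * real (CARD('n) + 1))"
    and B: "integrable M norm" "(\<integral>x. norm x \<partial>M) \<le> B"
  shows "norm (p $ i) \<le> 2 * real (CARD('n) + 1) * B + 1"
proof -
  interpret prob_space M using M by (simp add: prob_measures_iff)
  have sM: "sets M = sets borel" using M by (auto simp: prob_measures_iff)
  define N where "N = real (CARD('n) + 1)"
  have N: "N \<ge> 1" by (simp add: N_def)
  have r: "0 < r" "r \<le> \<epsilon>" and m: "\<bar>measure M (cball (p $ i) r) - 1 / N\<bar> \<le> \<epsilon>"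
    using cl(1) unfolding clustered_at_def N_def by auto
  have \<epsilon>: "\<epsilon> \<le> 1 / (2 * N)" using cl(2) by (simp add: N_def)
  have "1 / (2 * N) \<le> 1" using N by (simp add: divide_le_eq)
  then have r1: "r \<le> 1" using r(2) \<epsilon> by linarith
  have s: "cball (p $ i) r \<in> sets M" by (simp add: sM)
  have "1 / N = 1 / (2 * N) + 1 / (2 * N)" by (simp add: field_simps)
  then have w: "1 / (2 * N) \<le> measure M (cball (p $ i) r)" using m \<epsilon> by (simp only: abs_le_iff) linarith
  show ?thesis
  proof (cases "norm (p $ i) \<le> 1")
    case True
    have "0 \<le> B" using B(2) by (rule order_trans[rotated]) simp
    then have "0 \<le> 2 * real (CARD('n) + 1) * B" by simp
    then show ?thesis using True by linarith
  next
    case False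
    have "(norm (p $ i) - 1) * (1 / (2 * N)) \<le> (norm (p $ i) - 1) * measure M (cball (p $ i) r)"
      using False w by (intro mult_left_mono) auto
    also have "\<dots> = (\<integral>x. (norm (p $ i) - 1) * indicator (cball (p $ i) r) x \<partial>M)" using s by simp
    also have "\<dots> \<le> (\<integral>x. norm x \<partial>M)"
    proof (intro integral_mono B(1))
      show "integrable M (\<lambda>x. (norm (p $ i) - 1) * indicator (cball (p $ i) r) x)"
        using s by (intro integrable_mult_right integrable_real_indicator) (auto simp: emeasure_finite less_top[symmetric])
      fix x show "(norm (p $ i) - 1) * indicator (cball (p $ i) r) x \<le> norm x"
      proof (cases "x \<in> cball (p $ i) r")
        case True
        then have "norm (p $ i) - norm x \<le> r" using norm_triangle_ineq2[of "p $ i" x] by (simp add: dist_norm)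
        then show ?thesis using True r1 by simp
      qed simp
    qed
    finally have "(norm (p $ i) - 1) / (2 * N) \<le> B" using B(2) by simp
    then have "norm (p $ i) - 1 \<le> 2 * N * B" using N by (simp add: divide_le_eq mult.commute)
    then show ?thesis by (simp add: N_def)
  qed
qed

lemma integral_uniform_on_finite_set:
  fixes f :: "'a::euclidean_space \<Rightarrow> real"
  assumes "finite S" "S \<noteq> {}" "f \<in> borel_measurable borel"
  shows "(\<integral>x. f x \<partial>(distr (uniform_count_measure S) borel (\<lambda>x. x))) = (\<Sum>x\<in>S. f x / card S)"
proof -
  have "(\<lambda>x. x) \<in> measurable (uniform_count_measure S) borel"
    by (auto simp: measurable_def sets_uniform_count_measure space_uniform_count_measure)
  then show ?thesis using assms
    by (simp add: integral_distr integral_uniform_count_measure sum_divide_distrib)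
qed

text \<open>The choice of constants: \<open>d\<close> is the tolerance for the probability of being close, and \<open>e\<close>, the radius of
the balls, is taken so small that the errors in \<open>exists_clusters\<close> stay below it.\<close>

lemma eventually_clustered:
  fixes M :: "nat \<Rightarrow> (real ^ 'n) measure" and \<epsilon> :: real
  assumes M: "\<And>k. M k \<in> prob_measures"
    and off: "\<And>e. e > 0 \<Longrightarrow> (\<lambda>k. measure (M k \<Otimes>\<^sub>M M k) (off_simplex e)) \<longlonglongrightarrow> 0"
    and near: "\<And>d. d > 0 \<Longrightarrow> \<exists>\<rho>>0. \<forall>\<^sub>F k in sequentially.
        measure (M k \<Otimes>\<^sub>M M k) {z. dist (fst z) (snd z) \<le> \<rho>} \<le> 1 / (CARD('n) + 1) + d"
    and \<epsilon>: "\<epsilon> > 0"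
  shows "\<forall>\<^sub>F k in sequentially. \<exists>p r. clustered_at \<epsilon> (M k) p r"
proof -
  define N where "N = real (CARD('n) + 1)"
  have N: "N \<ge> 1" by (simp add: N_def)
  define d where "d = min (\<epsilon>\<^sup>2) (1 / N\<^sup>2) / 4"
  have d: "d > 0" using \<epsilon> N by (simp add: d_def)
  obtain \<rho> where \<rho>: "\<rho> > 0" and nearE: "\<forall>\<^sub>F k in sequentially.
        measure (M k \<Otimes>\<^sub>M M k) {z. dist (fst z) (snd z) \<le> \<rho>} \<le> 1 / N + d"
    using near[OF d] unfolding N_def by (elim exE conjE) (rule that[unfolded N_def])
  define e where "e = min (min \<epsilon> (\<rho> / 2)) (min (1 / (20 * N)) (d / (2 * (N + 1))))"
  have e: "e > 0" using \<epsilon> \<rho> N d by (simp add: e_def)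
  have e1: "e \<le> \<epsilon>" and e2: "2 * e \<le> \<rho>" and e3: "e \<le> 1 / (20 * N)" and e4: "e \<le> d / (2 * (N + 1))"
    unfolding e_def by linarith+
  have e3': "10 * e * N < 1"
  proof -
    have "e * (20 * N) \<le> 1" using e3 N by (simp add: le_divide_eq)
    then show ?thesis by simp
  qed
  have e4': "2 * ((N + 1) * e) \<le> d"
    using e4 N by (simp add: le_divide_eq algebra_simps)
  have d4: "d + 2 * ((N + 1) * e) \<le> \<epsilon>\<^sup>2" "d + 2 * ((N + 1) * e) < 1 / N\<^sup>2"
  proof -
    have "4 * d \<le> \<epsilon>\<^sup>2" "4 * d \<le> 1 / N\<^sup>2" by (simp_all add: d_def)
    then show "d + 2 * ((N + 1) * e) \<le> \<epsilon>\<^sup>2" "d + 2 * ((N + 1) * e) < 1 / N\<^sup>2" using d e4' by linarith+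
  qed
  have "\<forall>\<^sub>F k in sequentially. measure (M k \<Otimes>\<^sub>M M k) (off_simplex e) < e\<^sup>2"
    using off[OF e] e by (intro order_tendstoD(2)) auto
  with nearE show ?thesis
  proof eventually_elim
    case (elim k)
    interpret prob_space "M k" using M by (simp add: prob_measures_iff)
    interpret P: pair_prob_space "M k" "M k" ..
    have "measure (M k \<Otimes>\<^sub>M M k) {z. dist (fst z) (snd z) \<le> 2 * e} \<le> measure (M k \<Otimes>\<^sub>M M k) {z. dist (fst z) (snd z) \<le> \<rho>}"
    proof (rule P.finite_measure_mono)
      show "{z. dist (fst z) (snd z) \<le> \<rho>} \<in> P.events"
        by (rule distance_event_measurable[OF M]) simp
      show "{z::(real^'n) \<times> (real^'n). dist (fst z) (snd z) \<le> 2 * e} \<subseteq> {z. dist (fst z) (snd z) \<le> \<rho>}"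
        using e2 by (intro Collect_mono impI) linarith
    qed
    then have n: "measure (M k \<Otimes>\<^sub>M M k) {z. dist (fst z) (snd z) \<le> 2 * e} \<le> 1 / N + d"
      using elim(1) by linarith
    have "\<exists>p. clustered_at \<epsilon> (M k) p e"
      using exists_clusters[OF M e _ _ _ e1, of k d] e3' n d4 elim(2) unfolding N_def by simp
    then show ?case by (elim exE) (intro exI)
  qed
qed

text \<open>Choose a subsequence along which the clusters become exact, then a further one along which the tuple
of centers converges; the distances in the limit tuple are 1. The first moment bound is what
excludes an escape of the centers to infinity.\<close>

lemma weak_limit_is_unit_simplex:
  fixes M :: "nat \<Rightarrow> (real ^ 'n) measure" and B :: real
  assumes M: "\<And>k. M k \<in> prob_measures"
    and off: "\<And>e. e > 0 \<Longrightarrow> (\<lambda>k. measure (M k \<Otimes>\<^sub>M M k) (off_simplex e)) \<longlonglongrightarrow> 0"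
    and near: "\<And>d. d > 0 \<Longrightarrow> \<exists>\<rho>>0. \<forall>\<^sub>F k in sequentially.
        measure (M k \<Otimes>\<^sub>M M k) {z. dist (fst z) (snd z) \<le> \<rho>} \<le> 1 / (CARD('n) + 1) + d"
    and B: "\<And>k. integrable (M k) norm" "\<And>k. (\<integral>x. norm x \<partial>M k) \<le> B"
  shows "\<exists>s \<nu>. strict_mono s \<and> regular_unit_simplex \<nu> \<and> weakly_converges (\<lambda>k. M (s k)) \<nu>"
proof -
  define N where "N = real (CARD('n) + 1)"
  have N: "N \<ge> 2" by (simp add: N_def Suc_leI)
  define \<epsilon> where "\<epsilon> j = 1 / (2 * N * (real j + 1))" for j :: nat
  have \<epsilon>0: "\<epsilon> j > 0" and \<epsilon>N: "\<epsilon> j \<le> 1 / (2 * N)" for j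
    using N by (auto simp: \<epsilon>_def divide_simps)
  have "1 / (2 * N) \<le> 1 / 4" using N by (simp add: divide_simps)
  then have \<epsilon>4: "\<epsilon> j \<le> 1 / 4" for j using \<epsilon>N[of j] by linarith
  have \<epsilon>lim: "\<epsilon> \<longlonglongrightarrow> 0"
  proof -
    have "(\<lambda>j. 1 / (2 * N) * inverse (real (Suc j))) \<longlonglongrightarrow> 1 / (2 * N) * 0"
      by (intro tendsto_mult tendsto_const LIMSEQ_inverse_real_of_nat)
    then show ?thesis by (simp add: \<epsilon>_def[abs_def] field_simps)
  qed
  have ev: "\<forall>\<^sub>F k in sequentially. \<exists>p r. clustered_at (\<epsilon> j) (M k) p r" for j
    by (rule eventually_clustered[OF M off near \<epsilon>0])
  have "\<exists>s :: nat \<Rightarrow> nat. \<forall>j. (\<exists>p r. clustered_at (\<epsilon> j) (M (s j)) p r) \<and> s j < s (Suc j)"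
  proof (rule dependent_nat_choice)
    show "\<exists>k. \<exists>p r. clustered_at (\<epsilon> 0) (M k) p r" by (rule eventually_happens'[OF _ ev]) simp
    fix k j :: nat
    have "\<forall>\<^sub>F k' in sequentially. (\<exists>p r. clustered_at (\<epsilon> (Suc j)) (M k') p r) \<and> k < k'"
      by (intro eventually_conj ev eventually_gt_at_top)
    then show "\<exists>k'. (\<exists>p r. clustered_at (\<epsilon> (Suc j)) (M k') p r) \<and> k < k'"
      by (rule eventually_happens'[rotated]) simp
  qed
  then obtain s where s1: "\<And>j. \<exists>p r. clustered_at (\<epsilon> j) (M (s j)) p r" and s2: "\<And>j. s j < s (Suc j)"
    by metis
  have smono: "strict_mono s" using s2 by (simp add: strict_mono_Suc_iff)
  from s1 obtain p r where cl: "\<And>j. clustered_at (\<epsilon> j) (M (s j)) (p j) (r j)" by metis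
  define K where "K = 2 * N * B + 1"
  have comp: "norm (p j $ i) \<le> K" for i j
    using cluster_centre_bound[OF M cl _ B(1) B(2)] \<epsilon>N unfolding K_def N_def by simp
  have "norm (p j) \<le> (\<Sum>i\<in>(UNIV :: 'n option set). K)" for j
  proof -
    have "norm (p j) \<le> (\<Sum>i\<in>UNIV. norm (p j $ i))"
      unfolding norm_vec_def[of "p j"] by (rule L2_set_le_sum) simp
    also have "\<dots> \<le> (\<Sum>i\<in>(UNIV :: 'n option set). K)" by (intro sum_mono comp)
    finally show ?thesis .
  qed
  then have "bounded (range p)" unfolding bounded_iff by auto
  then obtain q t where t: "strict_mono t" and pq: "(p \<circ> t) \<longlonglongrightarrow> q"
    using bounded_imp_convergent_subsequence by metis
  have pqi: "(\<lambda>j. p (t j) $ i) \<longlonglongrightarrow> q $ i" for i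
    using tendsto_vec_nth[OF pq] by (simp add: comp_def)
  have \<epsilon>t: "(\<lambda>j. \<epsilon> (t j)) \<longlonglongrightarrow> 0" using LIMSEQ_subseq_LIMSEQ[OF \<epsilon>lim t] by (simp add: comp_def)
  have qd: "dist (q $ i) (q $ j) = 1" if "i \<noteq> j" for i j
  proof -
    have "(\<lambda>k. dist (p (t k) $ i) (p (t k) $ j) - 1) \<longlonglongrightarrow> 0"
    proof (rule Lim_null_comparison[OF _ \<epsilon>t], rule always_eventually, rule allI)
      fix k
      have "\<bar>dist (p (t k) $ i) (p (t k) $ j) - 1\<bar> \<le> r (t k)" "r (t k) \<le> \<epsilon> (t k)"
        using cl[of "t k"] that unfolding clustered_at_def by simp_all
      then show "norm (dist (p (t k) $ i) (p (t k) $ j) - 1) \<le> \<epsilon> (t k)" by simp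
    qed
    moreover have "(\<lambda>k. dist (p (t k) $ i) (p (t k) $ j) - 1) \<longlonglongrightarrow> dist (q $ i) (q $ j) - 1"
      by (intro tendsto_intros pqi)
    ultimately show ?thesis using LIMSEQ_unique by fastforce
  qed
  define S where "S = range (\<lambda>i. q $ i)"
  have inj: "inj (\<lambda>i. q $ i)"
    by (rule injI) (metis dist_self qd zero_neq_one)
  have cS: "card S = CARD('n) + 1" "finite S" "S \<noteq> {}"
    unfolding S_def using card_image[OF inj] by (simp_all add: card_UNIV_option)
  define \<nu> where "\<nu> = distr (uniform_count_measure S) borel (\<lambda>x. x)"
  have "regular_unit_simplex \<nu>"
    unfolding regular_unit_simplex_def
  proof (intro exI[of _ S] conjI ballI impI)
    show "dist x y = 1" if "x \<in> S" "y \<in> S" "x \<noteq> y" for x y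
      using that unfolding S_def by (auto intro!: qd)
  qed (use cS in \<open>simp_all add: \<nu>_def\<close>)
  moreover have "weakly_converges (\<lambda>k. M ((s \<circ> t) k)) \<nu>"
    unfolding weakly_converges_def
  proof (intro allI impI, elim conjE)
    fix f :: "real^'n \<Rightarrow> real"
    assume f: "continuous_on UNIV f" and "bounded (range f)"
    then obtain F where F: "\<And>x. \<bar>f x\<bar> \<le> F" unfolding bounded_iff by auto
    have nuf: "(\<integral>x. f x \<partial>\<nu>) = (\<Sum>i\<in>UNIV. f (q $ i) / (CARD('n) + 1))"
      unfolding \<nu>_def integral_uniform_on_finite_set[OF cS(2,3) borel_measurable_continuous_onI[OF f]] cS(1)
      unfolding S_def by (subst sum.reindex[OF inj]) simp
    show "(\<lambda>k. \<integral>x. f x \<partial>M ((s \<circ> t) k)) \<longlonglongrightarrow> (\<integral>x. f x \<partial>\<nu>)"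
    proof (rule metric_LIMSEQ_I)
      fix \<eta> :: real assume \<eta>: "\<eta> > 0"
      have cont: "\<exists>\<delta>>0. \<forall>x. dist x (q $ i) < \<delta> \<longrightarrow> dist (f x) (f (q $ i)) < \<eta> / 2" for i
        using f \<eta> unfolding continuous_on_iff by (metis UNIV_I half_gt_zero)
      then obtain \<delta> where \<delta>: "\<And>i. \<delta> i > 0" "\<And>i x. dist x (q $ i) < \<delta> i \<Longrightarrow> dist (f x) (f (q $ i)) < \<eta> / 2" by metis
      have e1: "\<forall>\<^sub>F k in sequentially. dist (p (t k) $ i) (q $ i) + \<epsilon> (t k) < \<delta> i" for i
      proof (rule order_tendstoD(2))
        show "(\<lambda>k. dist (p (t k) $ i) (q $ i) + \<epsilon> (t k)) \<longlonglongrightarrow> dist (q $ i) (q $ i) + 0"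
          by (intro tendsto_intros pqi \<epsilon>t)
      qed (simp add: \<delta>)
      have e2: "\<forall>\<^sub>F k in sequentially. 2 * N * F * \<epsilon> (t k) < \<eta> / 2"
      proof (rule order_tendstoD(2))
        show "(\<lambda>k. 2 * N * F * \<epsilon> (t k)) \<longlonglongrightarrow> 2 * N * F * 0" by (intro tendsto_intros \<epsilon>t)
      qed (simp add: \<eta>)
      have "\<forall>\<^sub>F k in sequentially. \<forall>i. dist (p (t k) $ i) (q $ i) + \<epsilon> (t k) < \<delta> i"
        using e1 by (simp add: eventually_all_finite)
      with e2 have "\<forall>\<^sub>F k in sequentially. dist (\<integral>x. f x \<partial>M ((s \<circ> t) k)) (\<integral>x. f x \<partial>\<nu>) < \<eta>"
      proof eventually_elim
        case (elim k)
        have "\<bar>(\<integral>x. f x \<partial>M (s (t k))) - (\<Sum>i\<in>UNIV. f (q $ i) / (CARD('n) + 1))\<bar> \<le> \<eta> / 2 + 2 * real (CARD('n) + 1) * F * \<epsilon> (t k)"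
        proof (rule integral_close_to_cluster_average[OF M cl \<epsilon>4 f F])
          fix i x assume x: "dist (p (t k) $ i) x \<le> r (t k)"
          have "r (t k) \<le> \<epsilon> (t k)" using cl[of "t k"] unfolding clustered_at_def by simp
          then have "dist x (q $ i) < \<delta> i"
            using x elim(2)[rule_format, of i] dist_triangle3[of x "q $ i" "p (t k) $ i"] by linarith
          then show "\<bar>f x - f (q $ i)\<bar> \<le> \<eta> / 2" using \<delta>(2) by (simp add: dist_real_def less_imp_le)
        qed (rule F)
        then show ?case using elim(1) unfolding nuf dist_real_def N_def comp_def by linarith
      qed
      then show "\<exists>k0. \<forall>k\<ge>k0. dist (\<integral>x. f x \<partial>M ((s \<circ> t) k)) (\<integral>x. f x \<partial>\<nu>) < \<eta>"
        unfolding eventually_sequentially .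
    qed
  qed
  moreover have "strict_mono (s \<circ> t)" using smono t by (rule strict_mono_o)
  ultimately show ?thesis by (intro exI[of _ "s \<circ> t"] exI[of _ \<nu>]) simp
qed

section \<open>The quartic interaction energy\<close>

lemma has_bochner_integral_pair_product:
  fixes f g :: "'a \<Rightarrow> real"
  assumes "prob_space M" and f: "integrable M f" and g: "integrable M g"
  shows "has_bochner_integral (M \<Otimes>\<^sub>M M) (\<lambda>z. f (fst z) * g (snd z)) ((\<integral>x. f x \<partial>M) * (\<integral>x. g x \<partial>M))"
proof -
  interpret prob_space M by fact
  interpret P: pair_prob_space M M ..
  have [measurable]: "f \<in> borel_measurable M" "g \<in> borel_measurable M" using f g by simp_all
  have int: "integrable (M \<Otimes>\<^sub>M M) (\<lambda>z. f (fst z) * g (snd z))"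
    by (rule P.Fubini_integrable) (use f g in \<open>simp_all add: abs_mult\<close>)
  moreover have "integral\<^sup>L (M \<Otimes>\<^sub>M M) (\<lambda>z. f (fst z) * g (snd z)) = (\<integral>x. f x \<partial>M) * (\<integral>x. g x \<partial>M)"
    using P.integral_fst'[OF int] by simp
  ultimately show ?thesis by (simp add: has_bochner_integral_iff)
qed

lemma integrable_of_norm_power_le:
  fixes f :: "'a::euclidean_space \<Rightarrow> real"
  assumes M: "M \<in> prob_measures" and p: "integrable M (\<lambda>x. norm x ^ p)"
    and f: "f \<in> borel_measurable borel" "\<And>x. \<bar>f x\<bar> \<le> norm x ^ k" and k: "k \<le> p"
  shows "integrable M f"
proof -
  interpret prob_space M using M by (simp add: prob_measures_iff)
  have sM: "sets M = sets borel" using M by (auto simp: prob_measures_iff)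
  have "integrable M (\<lambda>x. 1 + norm x ^ p)" using p by simp
  then show ?thesis
  proof (rule Bochner_Integration.integrable_bound)
    show "f \<in> borel_measurable M" using f(1) measurable_cong_sets[OF sM refl] by auto
    have "\<bar>f x\<bar> \<le> 1 + norm x ^ p" for x
    proof (cases "norm x \<le> 1")
      case True
      then have "norm x ^ k \<le> 1" by (simp add: power_le_one)
      then show ?thesis using f(2)[of x] zero_le_power[OF norm_ge_zero, of x p] by linarith
    next
      case False
      then have "norm x ^ k \<le> norm x ^ p" using k by (intro power_increasing) auto
      then show ?thesis using f(2)[of x] by linarith
    qed
    then show "AE x in M. norm (f x) \<le> norm (1 + norm x ^ p)" by (intro AE_I2) fastforce
  qed
qed

text \<open>Expanding \<open>|x - y|\<^sup>2 = |x|\<^sup>2 + |y|\<^sup>2 - 2 x \<bullet> y\<close> and integrating, all terms that are odd in one variable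
vanish because the mean is 0. With \<open>m\<^sub>2\<close> and \<open>m\<close> the second and fourth absolute moments and \<open>T\<close> the
second moment matrix, of trace \<open>m\<^sub>2\<close>, the value is \<open>2 m + 2 m\<^sub>2\<^sup>2 + 4 |T|\<^sup>2 - 4 m\<^sub>2\<close>. Cauchy-Schwarz
gives \<open>m \<ge> m\<^sub>2\<^sup>2\<close> and \<open>|T|\<^sup>2 \<ge> m\<^sub>2\<^sup>2 / n\<close>, and what remains is a quadratic polynomial in \<open>m\<^sub>2\<close>.\<close>

lemma quartic_interaction_bound:
  fixes M :: "'a::euclidean_space measure"
  assumes M: "M \<in> prob_measures" and m4: "integrable M (\<lambda>x. norm x ^ 4)" and mean: "(\<integral>x. x \<partial>M) = 0"
  shows "integrable (M \<Otimes>\<^sub>M M) (\<lambda>z. dist (fst z) (snd z) ^ 4 - 2 * dist (fst z) (snd z) ^ 2)"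
    and "- (DIM('a) / (DIM('a) + 1)) \<le> (\<integral>z. dist (fst z) (snd z) ^ 4 - 2 * dist (fst z) (snd z) ^ 2 \<partial>(M \<Otimes>\<^sub>M M))"
proof -
  interpret prob_space M using M by (simp add: prob_measures_iff)
  have sM[measurable_cong]: "sets M = sets borel" using M by (auto simp: prob_measures_iff)
  note hp = has_bochner_integral_pair_product[OF prob_space_axioms]
  have cs: "\<bar>x \<bullet> b\<bar> \<le> norm x" if "b \<in> Basis" for x b :: 'a
    by (rule Basis_le_norm[OF that])
  have i1: "integrable M (\<lambda>x. x \<bullet> b)" if "b \<in> Basis" for b
    by (rule integrable_of_norm_power_le[OF M m4, of _ 1]) (use cs[OF that] in simp_all)
  have i2: "integrable M (\<lambda>x. (x \<bullet> b) * (x \<bullet> c))" if "b \<in> Basis" "c \<in> Basis" for b c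
    by (rule integrable_of_norm_power_le[OF M m4, of _ 2])
      (use cs that in \<open>auto simp: abs_mult power2_eq_square intro!: mult_mono\<close>)
  have i3: "integrable M (\<lambda>x. (norm x)\<^sup>2 * (x \<bullet> b))" if "b \<in> Basis" for b
    by (rule integrable_of_norm_power_le[OF M m4, of _ 3])
      (use cs[OF that] in \<open>auto simp: abs_mult power3_eq_cube power2_eq_square intro!: mult_mono\<close>)
  have in2: "integrable M (\<lambda>x. (norm x)\<^sup>2)"
    by (rule integrable_of_norm_power_le[OF M m4, of _ 2]) simp_all
  have "integrable M (\<lambda>x. x)"
  proof -
    have "integrable M (\<lambda>x. norm x)"
      by (rule integrable_of_norm_power_le[OF M m4, of _ 1]) simp_all
    then show ?thesis by (rule integrable_norm_cancel) simp
  qed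
  then have mean0: "(\<integral>x. x \<bullet> b \<partial>M) = 0" for b
    using mean integral_inner_left[of b M "\<lambda>x. x"] by simp
  define m2 where "m2 = (\<integral>x. (norm x)\<^sup>2 \<partial>M)"
  define m where "m = (\<integral>x. norm x ^ 4 \<partial>M)"
  define T where "T b c = (\<integral>x. (x \<bullet> b) * (x \<bullet> c) \<partial>M)" for b c
  define V where "V b = (\<integral>x. (norm x)\<^sup>2 * (x \<bullet> b) \<partial>M)" for b
  define n where "n = real DIM('a)"
  have n: "n > 0" by (simp add: n_def)
  have expand: "dist x y ^ 4 - 2 * (dist x y)\<^sup>2 =
      norm x ^ 4 * 1 + norm y ^ 4 * 1 + 2 * ((norm x)\<^sup>2 * (norm y)\<^sup>2)
      + 4 * (\<Sum>b\<in>Basis. \<Sum>c\<in>Basis. ((x \<bullet> b) * (x \<bullet> c)) * ((y \<bullet> b) * (y \<bullet> c)))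
      - 4 * (\<Sum>b\<in>Basis. ((norm x)\<^sup>2 * (x \<bullet> b)) * (y \<bullet> b))
      - 4 * (\<Sum>b\<in>Basis. (x \<bullet> b) * ((norm y)\<^sup>2 * (y \<bullet> b)))
      - 2 * ((norm x)\<^sup>2 * 1) - 2 * ((norm y)\<^sup>2 * 1) + 4 * (\<Sum>b\<in>Basis. (x \<bullet> b) * (y \<bullet> b))" for x y :: 'a
  proof -
    define X Y Z where "X = (norm x)\<^sup>2" and "Y = (norm y)\<^sup>2" and "Z = x \<bullet> y"
    have D: "(dist x y)\<^sup>2 = X + Y - 2 * Z"
      unfolding dist_norm X_def Y_def Z_def power2_norm_eq_inner by (simp add: inner_diff inner_commute)
    have Z: "(\<Sum>b\<in>Basis. (x \<bullet> b) * (y \<bullet> b)) = Z" by (simp add: Z_def euclidean_inner[of x y])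
    have ZZ: "(\<Sum>b\<in>Basis. \<Sum>c\<in>Basis. ((x \<bullet> b) * (x \<bullet> c)) * ((y \<bullet> b) * (y \<bullet> c))) = Z * Z"
      unfolding Z[symmetric] sum_product by (intro sum.cong refl) (simp add: mult_ac)
    have XZ: "(\<Sum>b\<in>Basis. (X * (x \<bullet> b)) * (y \<bullet> b)) = X * Z"
      unfolding Z[symmetric] sum_distrib_left by (simp add: mult_ac)
    have YZ: "(\<Sum>b\<in>Basis. (x \<bullet> b) * (Y * (y \<bullet> b))) = Y * Z"
      unfolding Z[symmetric] sum_distrib_left by (simp add: mult_ac)
    have p4: "t ^ 4 = t\<^sup>2 * t\<^sup>2" for t :: real by (simp add: power2_eq_square power4_eq_xxxx)
    show ?thesis
      unfolding p4 X_def[symmetric] Y_def[symmetric] D Z ZZ XZ YZ by (simp add: algebra_simps)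
  qed
  have H: "has_bochner_integral (M \<Otimes>\<^sub>M M) (\<lambda>z. dist (fst z) (snd z) ^ 4 - 2 * (dist (fst z) (snd z))\<^sup>2)
     (m * 1 + m * 1 + 2 * (m2 * m2) + 4 * (\<Sum>b\<in>Basis. \<Sum>c\<in>Basis. T b c * T b c)
      - 4 * (\<Sum>b\<in>(Basis::'a set). V b * 0) - 4 * (\<Sum>b\<in>(Basis::'a set). 0 * V b)
      - 2 * (m2 * 1) - 2 * (m2 * 1) + 4 * (\<Sum>b\<in>(Basis::'a set). 0 * 0))"
    unfolding expand
  proof (intro has_bochner_integral_add has_bochner_integral_diff has_bochner_integral_mult_right
      has_bochner_integral_sum)
    have one: "integrable M (\<lambda>x. 1 :: real)" "(\<integral>x. 1 \<partial>M) = (1 :: real)" by (simp_all add: prob_space)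
    show "has_bochner_integral (M \<Otimes>\<^sub>M M) (\<lambda>z. norm (fst z) ^ 4 * 1) (m * 1)"
      using hp[OF m4 one(1)] unfolding m_def one(2) .
    show "has_bochner_integral (M \<Otimes>\<^sub>M M) (\<lambda>z. norm (snd z) ^ 4 * 1) (m * 1)"
      using hp[OF one(1) m4] unfolding m_def one(2) by simp
    show "has_bochner_integral (M \<Otimes>\<^sub>M M) (\<lambda>z. (norm (fst z))\<^sup>2 * (norm (snd z))\<^sup>2) (m2 * m2)"
      using hp[OF in2 in2] unfolding m2_def .
    show "has_bochner_integral (M \<Otimes>\<^sub>M M) (\<lambda>z. (norm (fst z))\<^sup>2 * 1) (m2 * 1)"
      using hp[OF in2 one(1)] unfolding m2_def one(2) .
    show "has_bochner_integral (M \<Otimes>\<^sub>M M) (\<lambda>z. (norm (snd z))\<^sup>2 * 1) (m2 * 1)"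
      using hp[OF one(1) in2] unfolding m2_def one(2) by simp
    fix b c :: 'a assume b: "b \<in> Basis"
    show "has_bochner_integral (M \<Otimes>\<^sub>M M) (\<lambda>z. (norm (fst z))\<^sup>2 * (fst z \<bullet> b) * (snd z \<bullet> b)) (V b * 0)"
      using hp[OF i3[OF b] i1[OF b]] unfolding V_def mean0 .
    show "has_bochner_integral (M \<Otimes>\<^sub>M M) (\<lambda>z. (fst z \<bullet> b) * ((norm (snd z))\<^sup>2 * (snd z \<bullet> b))) (0 * V b)"
      using hp[OF i1[OF b] i3[OF b]] unfolding V_def mean0 .
    show "has_bochner_integral (M \<Otimes>\<^sub>M M) (\<lambda>z. (fst z \<bullet> b) * (snd z \<bullet> b)) (0 * 0)"
      using hp[OF i1[OF b] i1[OF b]] unfolding mean0 .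
    assume c: "c \<in> Basis"
    show "has_bochner_integral (M \<Otimes>\<^sub>M M) (\<lambda>z. (fst z \<bullet> b) * (fst z \<bullet> c) * ((snd z \<bullet> b) * (snd z \<bullet> c))) (T b c * T b c)"
      using hp[OF i2[OF b c] i2[OF b c]] unfolding T_def .
  qed
  then show "integrable (M \<Otimes>\<^sub>M M) (\<lambda>z. dist (fst z) (snd z) ^ 4 - 2 * dist (fst z) (snd z) ^ 2)"
    by (rule has_bochner_integral_iff[THEN iffD1, THEN conjunct1])
  have I: "(\<integral>z. dist (fst z) (snd z) ^ 4 - 2 * (dist (fst z) (snd z))\<^sup>2 \<partial>(M \<Otimes>\<^sub>M M))
     = 2 * m + 2 * m2\<^sup>2 + 4 * (\<Sum>b\<in>Basis. \<Sum>c\<in>Basis. T b c * T b c) - 4 * m2"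
    using H[THEN has_bochner_integral_integral_eq] by (simp add: power2_eq_square)
  have mm: "m2\<^sup>2 \<le> m"
  proof -
    have "0 \<le> (\<integral>x. ((norm x)\<^sup>2 - m2)\<^sup>2 \<partial>M)" by simp
    also have "(\<lambda>x. ((norm x)\<^sup>2 - m2)\<^sup>2) = (\<lambda>x. norm x ^ 4 - 2 * m2 * (norm x)\<^sup>2 + m2\<^sup>2)"
      by (rule ext) (simp add: power2_eq_square power4_eq_xxxx algebra_simps)
    also have "(\<integral>x. norm x ^ 4 - 2 * m2 * (norm x)\<^sup>2 + m2\<^sup>2 \<partial>M) = m - 2 * m2 * m2 + m2\<^sup>2"
      using m4 in2 by (simp add: m_def m2_def prob_space)
    finally show ?thesis by (simp add: power2_eq_square)
  qed
  have TT: "m2\<^sup>2 \<le> n * (\<Sum>b\<in>Basis. \<Sum>c\<in>Basis. T b c * T b c)"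
  proof -
    have "m2 = (\<integral>x. (\<Sum>b\<in>Basis. (x \<bullet> b) * (x \<bullet> b)) \<partial>M)"
      unfolding m2_def by (simp add: euclidean_inner[symmetric] power2_norm_eq_inner)
    also have "\<dots> = (\<Sum>b\<in>Basis. T b b)"
      unfolding T_def by (rule Bochner_Integration.integral_sum) (rule i2)
    finally have "m2\<^sup>2 = (\<Sum>b\<in>Basis. T b b)\<^sup>2" by simp
    also have "\<dots> \<le> n * (\<Sum>b\<in>Basis. (T b b)\<^sup>2)"
      using sum_squared_le_sum_of_squares[of "\<lambda>b. T b b" "Basis :: 'a set"] by (simp add: n_def mult.commute)
    also have "\<dots> \<le> n * (\<Sum>b\<in>Basis. \<Sum>c\<in>Basis. T b c * T b c)"
    proof (intro mult_left_mono sum_mono)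
      fix b :: 'a assume "b \<in> Basis"
      then show "(T b b)\<^sup>2 \<le> (\<Sum>c\<in>Basis. T b c * T b c)"
        unfolding power2_eq_square by (intro member_le_sum) auto
    qed (use n in simp)
    finally show ?thesis .
  qed
  \<comment> \<open>The quadratic polynomial in \<open>m2\<close> has its minimum at the second moment of the unit simplex.\<close>
  have "- (n / (n + 1)) \<le> 4 * m2\<^sup>2 + 4 * (m2\<^sup>2 / n) - 4 * m2"
  proof -
    have "4 * m2\<^sup>2 + 4 * (m2\<^sup>2 / n) - 4 * m2 + n / (n + 1) = 4 * ((n + 1) / n) * (m2 - n / (2 * (n + 1)))\<^sup>2"
      using n by (simp add: power2_eq_square divide_simps) (simp add: algebra_simps)
    also have "\<dots> \<ge> 0" using n by simp
    finally show ?thesis by simp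
  qed
  also have "\<dots> \<le> 2 * m + 2 * m2\<^sup>2 + 4 * (\<Sum>b\<in>Basis. \<Sum>c\<in>Basis. T b c * T b c) - 4 * m2"
  proof -
    have "m2\<^sup>2 / n \<le> (\<Sum>b\<in>Basis. \<Sum>c\<in>Basis. T b c * T b c)"
      using TT n by (simp add: divide_le_eq mult.commute)
    then show ?thesis using mm by linarith
  qed
  finally show "- (DIM('a) / (DIM('a) + 1)) \<le> (\<integral>z. dist (fst z) (snd z) ^ 4 - 2 * dist (fst z) (snd z) ^ 2 \<partial>(M \<Otimes>\<^sub>M M))"
    unfolding I n_def by (simp add: add.commute)
qed

section \<open>Comparison of powers\<close>

text \<open>The coefficient for which \<open>tangent_coeff \<alpha> q * (r powr q - q / 2 * r\<^sup>2)\<close> agrees with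
\<open>r powr \<alpha> / \<alpha> - r\<^sup>2 / 2\<close> at \<open>r = 1\<close>; the derivatives of both vanish there.\<close>

definition tangent_coeff :: "real \<Rightarrow> real \<Rightarrow> real" where
  "tangent_coeff \<alpha> q = (\<alpha> - 2) / (\<alpha> * (q - 2))"

definition power_gap :: "real \<Rightarrow> real \<Rightarrow> real \<Rightarrow> real" where
  "power_gap \<alpha> q r = (r powr \<alpha> / \<alpha> - r\<^sup>2 / 2) - tangent_coeff \<alpha> q * (r powr q - q / 2 * r\<^sup>2)"

text \<open>The gap divided by \<open>r\<^sup>2\<close>, which makes the sign of the derivative visible.\<close>

definition reduced_gap :: "real \<Rightarrow> real \<Rightarrow> real \<Rightarrow> real" where
  "reduced_gap \<alpha> q r = r powr (\<alpha> - 2) / \<alpha> - tangent_coeff \<alpha> q * r powr (q - 2) + (tangent_coeff \<alpha> q * q / 2 - 1 / 2)"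

lemma power_gap_eq_reduced: "r > 0 \<Longrightarrow> power_gap \<alpha> q r = r\<^sup>2 * reduced_gap \<alpha> q r"
proof -
  assume r: "r > 0"
  have p: "r powr s = r\<^sup>2 * r powr (s - 2)" for s
    using r powr_add[of r 2 "s - 2"] by (simp add: powr_numeral)
  show ?thesis unfolding power_gap_def reduced_gap_def p[of \<alpha>] p[of q] by (simp add: algebra_simps)
qed

lemma reduced_gap_1: "2 < q \<Longrightarrow> 2 < \<alpha> \<Longrightarrow> reduced_gap \<alpha> q 1 = 0"
  unfolding reduced_gap_def tangent_coeff_def by (simp add: divide_simps) (simp add: algebra_simps)

text \<open>The derivative has the sign of \<open>r - 1\<close> if \<open>q \<le> \<alpha>\<close>, so \<open>r = 1\<close> is the minimum, of value 0.\<close>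

lemma has_derivative_reduced_gap:
  assumes "2 < q" "2 < \<alpha>" "r > 0"
  shows "(reduced_gap \<alpha> q has_real_derivative (\<alpha> - 2) / \<alpha> * (r powr (\<alpha> - 3) - r powr (q - 3))) (at r)"
proof -
  have "(reduced_gap \<alpha> q has_real_derivative
      (\<alpha> - 2) * r powr (\<alpha> - 2 - 1) / \<alpha> - tangent_coeff \<alpha> q * ((q - 2) * r powr (q - 2 - 1)) + 0) (at r)"
    unfolding reduced_gap_def[abs_def] using assms
    by (intro derivative_intros DERIV_cdivide DERIV_cmult has_real_derivative_powr) auto
  moreover have "tangent_coeff \<alpha> q * ((q - 2) * r powr (q - 2 - 1)) = (\<alpha> - 2) / \<alpha> * r powr (q - 3)"
    using assms by (simp add: tangent_coeff_def)
  ultimately show ?thesis by (simp add: right_diff_distrib)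
qed

lemma reduced_gap_mono:
  assumes "2 < q" "q \<le> \<alpha>" "1 \<le> r" "r \<le> s"
  shows "reduced_gap \<alpha> q r \<le> reduced_gap \<alpha> q s"
proof (rule DERIV_nonneg_imp_nondecreasing[OF assms(4)])
  fix x assume x: "r \<le> x" "x \<le> s"
  then have "x powr (q - 3) \<le> x powr (\<alpha> - 3)" using assms by (intro powr_mono) auto
  then show "\<exists>y. (reduced_gap \<alpha> q has_real_derivative y) (at x) \<and> 0 \<le> y"
    using x assms by (intro exI[of _ "(\<alpha> - 2) / \<alpha> * (x powr (\<alpha> - 3) - x powr (q - 3))"] conjI has_derivative_reduced_gap mult_nonneg_nonneg) auto
qed

lemma reduced_gap_antimono:
  assumes "2 < q" "q \<le> \<alpha>" "0 < r" "r \<le> s" "s \<le> 1"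
  shows "reduced_gap \<alpha> q s \<le> reduced_gap \<alpha> q r"
proof (rule DERIV_nonpos_imp_nonincreasing[OF assms(4)])
  fix x assume x: "r \<le> x" "x \<le> s"
  then have "x powr (\<alpha> - 3) \<le> x powr (q - 3)" using assms by (intro powr_mono') auto
  then show "\<exists>y. (reduced_gap \<alpha> q has_real_derivative y) (at x) \<and> y \<le> 0"
    using x assms by (intro exI[of _ "(\<alpha> - 2) / \<alpha> * (x powr (\<alpha> - 3) - x powr (q - 3))"] conjI has_derivative_reduced_gap mult_nonneg_nonpos) auto
qed

lemma reduced_gap_pos:
  assumes "2 < q" "q < \<alpha>" "0 < r" "r \<noteq> 1"
  shows "0 < reduced_gap \<alpha> q r"
proof (cases "r < 1")
  case True
  have "reduced_gap \<alpha> q 1 < reduced_gap \<alpha> q r"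
  proof (rule DERIV_neg_imp_decreasing_open[OF True])
    fix x assume x: "r < x" "x < 1"
    then have "x powr (\<alpha> - 3) < x powr (q - 3)" using assms by (intro powr_less_mono') auto
    then show "\<exists>y. (reduced_gap \<alpha> q has_real_derivative y) (at x) \<and> y < 0"
      using x assms by (intro exI[of _ "(\<alpha> - 2) / \<alpha> * (x powr (\<alpha> - 3) - x powr (q - 3))"] conjI has_derivative_reduced_gap mult_pos_neg) auto
  qed (use assms in \<open>auto intro!: continuous_at_imp_continuous_on DERIV_isCont has_derivative_reduced_gap\<close>)
  then show ?thesis using assms by (simp add: reduced_gap_1)
next
  case False
  then have r: "1 < r" using assms by simp
  have "reduced_gap \<alpha> q 1 < reduced_gap \<alpha> q r"
  proof (rule DERIV_pos_imp_increasing_open[OF r])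
    fix x assume x: "1 < x" "x < r"
    then have "x powr (q - 3) < x powr (\<alpha> - 3)" using assms by (intro powr_less_mono) auto
    then show "\<exists>y. (reduced_gap \<alpha> q has_real_derivative y) (at x) \<and> 0 < y"
      using x assms by (intro exI[of _ "(\<alpha> - 2) / \<alpha> * (x powr (\<alpha> - 3) - x powr (q - 3))"] conjI has_derivative_reduced_gap mult_pos_pos) auto
  qed (use assms in \<open>auto intro!: continuous_at_imp_continuous_on DERIV_isCont has_derivative_reduced_gap\<close>)
  then show ?thesis using assms by (simp add: reduced_gap_1)
qed

lemma power_gap_nonneg:
  assumes "2 < q" "q \<le> \<alpha>" "0 \<le> r"
  shows "0 \<le> power_gap \<alpha> q r"
proof (cases "r = 0")
  case True then show ?thesis by (simp add: power_gap_def)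
next
  case False
  then have r: "r > 0" using assms by simp
  have "reduced_gap \<alpha> q 1 \<le> reduced_gap \<alpha> q r"
  proof (cases "r \<le> 1")
    case True then show ?thesis using assms r by (intro reduced_gap_antimono) auto
  next
    case False then show ?thesis using assms by (intro reduced_gap_mono) auto
  qed
  then show ?thesis using r assms by (simp add: reduced_gap_1 power_gap_eq_reduced)
qed

text \<open>Monotonicity on either side of 1 makes the lower bound uniform over the unbounded set of admissible
distances.\<close>

lemma power_gap_lower_bound:
  assumes "2 < q" "q < \<alpha>" "0 < e" "e < 1"
  shows "\<exists>c>0. \<forall>r. e < r \<longrightarrow> e < \<bar>r - 1\<bar> \<longrightarrow> c \<le> power_gap \<alpha> q r"
proof -
  define c where "c = min (reduced_gap \<alpha> q (1 - e)) (reduced_gap \<alpha> q (1 + e))"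
  have c: "c > 0" using assms by (simp add: c_def reduced_gap_pos)
  have "e\<^sup>2 * c \<le> power_gap \<alpha> q r" if r: "e < r" "e < \<bar>r - 1\<bar>" for r
  proof -
    have "c \<le> reduced_gap \<alpha> q r"
    proof (cases "r < 1")
      case True
      then have "reduced_gap \<alpha> q (1 - e) \<le> reduced_gap \<alpha> q r"
        using r assms by (intro reduced_gap_antimono) auto
      then show ?thesis by (simp add: c_def)
    next
      case False
      then have "reduced_gap \<alpha> q (1 + e) \<le> reduced_gap \<alpha> q r"
        using r assms by (intro reduced_gap_mono) auto
      then show ?thesis by (simp add: c_def)
    qed
    then have "e\<^sup>2 * c \<le> r\<^sup>2 * reduced_gap \<alpha> q r"
      using r assms c by (intro mult_mono power_mono) auto
    then show ?thesis using r assms by (simp add: power_gap_eq_reduced)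
  qed
  moreover have "e\<^sup>2 * c > 0" using assms c by simp
  ultimately show ?thesis by (intro exI[of _ "e\<^sup>2 * c"]) simp
qed

section \<open>Measures with finite distance moment\<close>

text \<open>The functional at \<open>\<beta> = 2\<close> without the factor \<open>1 / 2\<close>. As a Bochner integral it is meaningful
for measures with finite distance moment of order \<open>\<alpha>\<close>.\<close>

definition limit_energy :: "real \<Rightarrow> 'a::euclidean_space measure \<Rightarrow> real" where
  "limit_energy \<alpha> M = (\<integral>z. dist (fst z) (snd z) powr \<alpha> / \<alpha> - (dist (fst z) (snd z))\<^sup>2 / 2 \<partial>(M \<Otimes>\<^sub>M M))"

definition has_distance_moment :: "real \<Rightarrow> 'a::euclidean_space measure \<Rightarrow> bool" where
  "has_distance_moment \<alpha> M \<longleftrightarrow> M \<in> prob_measures \<and> integrable (M \<Otimes>\<^sub>M M) (\<lambda>z. dist (fst z) (snd z) powr \<alpha>)"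

lemma dist_pair_measurable:
  fixes M :: "'a::euclidean_space measure"
  assumes "M \<in> prob_measures" "f \<in> borel_measurable borel"
  shows "(\<lambda>z. f (dist (fst z) (snd z)) :: real) \<in> borel_measurable (M \<Otimes>\<^sub>M M)"
proof -
  have "(\<lambda>z::'a \<times> 'a. dist (fst z) (snd z)) \<in> borel_measurable borel"
    by (intro borel_measurable_continuous_onI continuous_intros)
  then have "(\<lambda>z::'a \<times> 'a. f (dist (fst z) (snd z))) \<in> borel_measurable borel"
    by (rule measurable_compose) (rule assms(2))
  then show ?thesis using measurable_cong_sets[OF pair_sets_borel[OF assms(1)] refl] by auto
qed

lemma integrable_dist_powr:
  fixes M :: "'a::euclidean_space measure"
  assumes "has_distance_moment \<alpha> M" "0 \<le> q" "q \<le> \<alpha>"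
  shows "integrable (M \<Otimes>\<^sub>M M) (\<lambda>z. dist (fst z) (snd z) powr q)"
proof -
  have M: "M \<in> prob_measures" and i: "integrable (M \<Otimes>\<^sub>M M) (\<lambda>z. dist (fst z) (snd z) powr \<alpha>)"
    using assms by (auto simp: has_distance_moment_def)
  interpret prob_space M using M by (simp add: prob_measures_iff)
  interpret P: pair_prob_space M M ..
  have "integrable (M \<Otimes>\<^sub>M M) (\<lambda>z. 1 + dist (fst z) (snd z) powr \<alpha>)" using i by simp
  then show ?thesis
  proof (rule Bochner_Integration.integrable_bound)
    show "(\<lambda>z. dist (fst z) (snd z) powr q) \<in> borel_measurable (M \<Otimes>\<^sub>M M)"
      by (rule dist_pair_measurable[OF M]) simp
    have "r powr q \<le> 1 + r powr \<alpha>" if "r \<ge> 0" for r :: real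
    proof (cases "r \<le> 1")
      case True then have "r powr q \<le> 1" using that assms(2) by (intro powr_le1) auto
      then show ?thesis by (simp add: add_increasing2)
    next
      case False then have "r powr q \<le> r powr \<alpha>" using assms by (intro powr_mono) auto
      then show ?thesis by simp
    qed
    then show "AE z in M \<Otimes>\<^sub>M M. norm (dist (fst z) (snd z) powr q) \<le> norm (1 + dist (fst z) (snd z) powr \<alpha>)"
      by (intro AE_I2) simp
  qed
qed

lemma integrable_dist_power:
  fixes M :: "'a::euclidean_space measure"
  assumes "has_distance_moment \<alpha> M" "real k \<le> \<alpha>"
  shows "integrable (M \<Otimes>\<^sub>M M) (\<lambda>z. dist (fst z) (snd z) ^ k)"
proof (cases "k = 0")
  case True
  have "M \<in> prob_measures" using assms(1) by (simp add: has_distance_moment_def)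
  then interpret prob_space M by (simp add: prob_measures_iff)
  interpret P: pair_prob_space M M ..
  show ?thesis using True by simp
next
  case False
  have "r powr real k = r ^ k" if "r \<ge> 0" for r :: real
    using that False by (cases "r = 0") (simp_all add: powr_realpow)
  then show ?thesis using integrable_dist_powr[OF assms(1) _ assms(2)] by simp
qed

text \<open>By Fubini, \<open>|x - y| ^ k\<close> is integrable in \<open>y\<close> for some fixed \<open>x\<close>, and the norm of \<open>y\<close> is at most
\<open>|x - y| + |x|\<close>.\<close>

lemma integrable_norm_power:
  fixes M :: "'a::euclidean_space measure"
  assumes D: "has_distance_moment \<alpha> M" "real k \<le> \<alpha>"
  shows "integrable M (\<lambda>x. norm x ^ k)"
proof -
  have M: "M \<in> prob_measures" using D(1) by (simp add: has_distance_moment_def)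
  interpret prob_space M using M by (simp add: prob_measures_iff)
  interpret P: pair_prob_space M M ..
  have sM[measurable_cong]: "sets M = sets borel" using M by (auto simp: prob_measures_iff)
  have "AE x in M. integrable M (\<lambda>y. dist x y ^ k)"
    using P.AE_integrable_fst'[OF integrable_dist_power[OF D]] by simp
  then obtain x where x: "integrable M (\<lambda>y. dist x y ^ k)"
    using eventually_happens'[OF ae_filter_bot] by auto
  have "integrable M (\<lambda>y. 2 ^ k * (dist x y ^ k + norm x ^ k))" using x by simp
  then show ?thesis
  proof (rule Bochner_Integration.integrable_bound)
    show "(\<lambda>x. norm x ^ k) \<in> borel_measurable M" by measurable
    have "norm y ^ k \<le> 2 ^ k * (dist x y ^ k + norm x ^ k)" for y
    proof -
      define a b where "a = dist x y" and "b = norm x"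
      have ab: "0 \<le> a" "0 \<le> b" by (auto simp: a_def b_def)
      have "norm y \<le> a + b" using norm_triangle_sub[of y x] by (simp add: a_def b_def dist_norm norm_minus_commute)
      also have "\<dots> \<le> 2 * max a b" by simp
      finally have "norm y ^ k \<le> (2 * max a b) ^ k" by (intro power_mono) auto
      also have "\<dots> = 2 ^ k * max a b ^ k" by (simp add: power_mult_distrib)
      also have "\<dots> \<le> 2 ^ k * (a ^ k + b ^ k)" using ab by (intro mult_left_mono) (auto simp: max_def)
      finally show ?thesis by (simp add: a_def b_def)
    qed
    then show "AE y in M. norm (norm y ^ k) \<le> norm (2 ^ k * (dist x y ^ k + norm x ^ k))"
      by (intro AE_I2) simp
  qed
qed

text \<open>The average of the gap between the kernel and its quartic minorant is at most the excess of the limit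
energy over its minimum, because the minorant has the same minimum. The gap is bounded away from 0 on
the exceptional pairs.\<close>

lemma off_simplex_small_of_quartic_growth:
  fixes e \<eta> \<alpha> :: real
  assumes \<alpha>: "\<alpha> > 4" and e: "0 < e" "e < 1" and \<eta>: "\<eta> > 0"
  shows "\<exists>\<delta>>0. \<forall>M :: 'a::euclidean_space measure. has_distance_moment \<alpha> M \<longrightarrow> (\<integral>x. x \<partial>M) = 0 \<longrightarrow>
     limit_energy \<alpha> M \<le> - (1 / 2 - 1 / \<alpha>) * (DIM('a) / (DIM('a) + 1)) + \<delta> \<longrightarrow>
     measure (M \<Otimes>\<^sub>M M) (off_simplex e) \<le> \<eta>"
proof -
  obtain c where c: "c > 0" "\<And>r. e < r \<Longrightarrow> e < \<bar>r - 1\<bar> \<Longrightarrow> c \<le> power_gap \<alpha> 4 r"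
    using power_gap_lower_bound[of 4 \<alpha> e] \<alpha> e by auto
  define \<kappa> where "\<kappa> = 1 / 2 - 1 / \<alpha>"
  have \<kappa>: "\<kappa> > 0" "tangent_coeff \<alpha> 4 = \<kappa>" using \<alpha> by (auto simp: \<kappa>_def tangent_coeff_def field_simps)
  have gap: "power_gap \<alpha> 4 r = (r powr \<alpha> / \<alpha> - r\<^sup>2 / 2) - \<kappa> * (r ^ 4 - 2 * r\<^sup>2)" if "r \<ge> 0" for r
    using that unfolding power_gap_def \<kappa>(2) by (cases "r = 0") (simp_all add: powr_numeral)
  have "measure (M \<Otimes>\<^sub>M M) (off_simplex e) \<le> \<eta>"
    if D: "has_distance_moment \<alpha> M" and mean: "(\<integral>x. x \<partial>M) = 0"
      and J: "limit_energy \<alpha> M \<le> - (1 / 2 - 1 / \<alpha>) * (DIM('a) / (DIM('a) + 1)) + c * \<eta>"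
    for M :: "'a measure"
  proof -
    have M: "M \<in> prob_measures" using D by (simp add: has_distance_moment_def)
    interpret prob_space M using M by (simp add: prob_measures_iff)
    interpret P: pair_prob_space M M ..
    have sp: "space (M \<Otimes>\<^sub>M M) = UNIV" by (simp add: space_pair_measure space_prob_measures[OF M])
    let ?g = "\<lambda>z::'a \<times> 'a. dist (fst z) (snd z) powr \<alpha> / \<alpha> - (dist (fst z) (snd z))\<^sup>2 / 2"
    let ?q = "\<lambda>z::'a \<times> 'a. dist (fst z) (snd z) ^ 4 - 2 * (dist (fst z) (snd z))\<^sup>2"
    have ig: "integrable (M \<Otimes>\<^sub>M M) ?g"
      using integrable_dist_powr[OF D, of \<alpha>] integrable_dist_power[OF D, of 2] \<alpha> by simp
    have m4: "integrable M (\<lambda>x. norm x ^ 4)" using integrable_norm_power[OF D, of 4] \<alpha> by simp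
    note q = quartic_interaction_bound[OF M m4 mean]
    let ?h = "\<lambda>z::'a \<times> 'a. power_gap \<alpha> 4 (dist (fst z) (snd z))"
    have h: "?h = (\<lambda>z. ?g z - \<kappa> * ?q z)" by (rule ext) (simp add: gap)
    have ih: "integrable (M \<Otimes>\<^sub>M M) ?h" unfolding h using ig q(1) by simp
    have "(\<integral>z. ?h z \<partial>(M \<Otimes>\<^sub>M M)) = limit_energy \<alpha> M - \<kappa> * (\<integral>z. ?q z \<partial>(M \<Otimes>\<^sub>M M))"
      unfolding h limit_energy_def using ig q(1) by simp
    also have "\<dots> \<le> limit_energy \<alpha> M - \<kappa> * (- (DIM('a) / (DIM('a) + 1)))"
      using q(2) \<kappa>(1) by (intro diff_left_mono mult_left_mono) auto
    also have "\<dots> \<le> c * \<eta>" using J unfolding \<kappa>_def[symmetric] by simp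
    finally have I: "(\<integral>z. ?h z \<partial>(M \<Otimes>\<^sub>M M)) \<le> c * \<eta>" .
    have "measure (M \<Otimes>\<^sub>M M) (off_simplex e) \<le> measure (M \<Otimes>\<^sub>M M) {z \<in> space (M \<Otimes>\<^sub>M M). c \<le> ?h z}"
    proof (rule P.finite_measure_mono)
      show "off_simplex e \<subseteq> {z \<in> space (M \<Otimes>\<^sub>M M). c \<le> ?h z}" using c(2) by (auto simp: sp)
      show "{z \<in> space (M \<Otimes>\<^sub>M M). c \<le> ?h z} \<in> sets (M \<Otimes>\<^sub>M M)"
        using ih by measurable
    qed
    also have "\<dots> \<le> (\<integral>z. ?h z \<partial>(M \<Otimes>\<^sub>M M)) / c"
      by (rule integral_Markov_inequality_measure[OF ih sets.empty_sets _ c(1)])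
        (use \<alpha> in \<open>auto intro!: AE_I2 power_gap_nonneg\<close>)
    also have "\<dots> \<le> \<eta>" using I c(1) by (simp add: divide_le_eq mult.commute)
    finally show ?thesis .
  qed
  then show ?thesis using c(1) \<eta> by (intro exI[of _ "c * \<eta>"]) simp
qed

section \<open>Rigidity of the cubic energy on the line\<close>

lemma nn_integral_of_has_bochner_integral:
  fixes f :: "'a \<Rightarrow> real"
  assumes "has_bochner_integral M f v" "\<And>x. 0 \<le> f x"
  shows "(\<integral>\<^sup>+x. ennreal (f x) \<partial>M) = ennreal v"
  using assms nn_integral_eq_integral[of M f] by (auto simp: has_bochner_integral_iff)

text \<open>The integrand is \<open>2 (t - x) (y - t)\<close> between \<open>x\<close> and \<open>y\<close>, and 0 elsewhere. This writes \<open>|x - y| ^ 3\<close>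
as a superposition of products of a function of \<open>x\<close> and one of \<open>y\<close>.\<close>

lemma abs_product_kernel:
  fixes x y :: real
  shows "has_bochner_integral lborel (\<lambda>t. \<bar>x - t\<bar> * \<bar>y - t\<bar> - (x - t) * (y - t)) (\<bar>x - y\<bar> ^ 3 / 3)"
proof (induction x y rule: linorder_wlog)
  case (le x y)
  define F where "F t = (x + y) * t\<^sup>2 - 2 * t ^ 3 / 3 - 2 * x * y * t" for t :: real
  have "has_bochner_integral lborel (\<lambda>t. (2 * (t - x) * (y - t)) * indicator {x..y} t) (F y - F x)"
  proof (rule has_bochner_integral_FTC_Icc_real[OF le])
    fix t
    show "(F has_real_derivative 2 * (t - x) * (y - t)) (at t)"
      unfolding F_def by (auto intro!: derivative_eq_intros simp: algebra_simps power2_eq_square)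
  qed (auto intro!: continuous_intros)
  moreover have "(\<lambda>t. (2 * (t - x) * (y - t)) * indicator {x..y} t) = (\<lambda>t. \<bar>x - t\<bar> * \<bar>y - t\<bar> - (x - t) * (y - t))"
    using le by (intro ext) (auto simp: indicator_def abs_if algebra_simps)
  moreover have "F y - F x = \<bar>x - y\<bar> ^ 3 / 3"
    using le unfolding F_def by (simp add: abs_if power3_eq_cube power2_eq_square field_simps)
  ultimately show ?case by simp
next
  case (sym x y)
  then show ?case by (simp add: mult.commute abs_minus_commute)
qed

text \<open>The integrand is \<open>2 (|x| - |t|)\<close> between 0 and \<open>x\<close>, and 0 elsewhere, apart from the negligible point \<open>t = 0\<close>.
The term linear in \<open>x\<close> disappears when one averages over a centered variable.\<close>

lemma abs_kernel:
  fixes x :: real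
  shows "has_bochner_integral lborel (\<lambda>t. \<bar>x - t\<bar> - \<bar>t\<bar> + x * (if t \<le> 0 then -1 else 1)) (x\<^sup>2)"
proof -
  define a b where "a = min 0 x" and "b = max 0 x"
  define F where "F t = 2 * \<bar>x\<bar> * t - (if x \<ge> 0 then t\<^sup>2 else - t\<^sup>2)" for t :: real
  have "has_bochner_integral lborel (\<lambda>t. (2 * \<bar>x\<bar> - (if x \<ge> 0 then 2 * t else - 2 * t)) * indicator {a..b} t) (F b - F a)"
  proof (rule has_bochner_integral_FTC_Icc_real)
    show "a \<le> b" by (simp add: a_def b_def)
    fix t
    show "(F has_real_derivative 2 * \<bar>x\<bar> - (if x \<ge> 0 then 2 * t else - 2 * t)) (at t)"
      unfolding F_def by (cases "x \<ge> 0") (auto intro!: derivative_eq_intros)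
    show "isCont (\<lambda>t. 2 * \<bar>x\<bar> - (if x \<ge> 0 then 2 * t else - 2 * t)) t"
      by (cases "x \<ge> 0") (auto intro!: continuous_intros)
  qed
  moreover have "F b - F a = x\<^sup>2" unfolding F_def a_def b_def
    by (cases "x \<ge> 0") (auto simp: power2_eq_square min_def max_def algebra_simps)
  ultimately have *: "has_bochner_integral lborel (\<lambda>t. (2 * \<bar>x\<bar> - (if x \<ge> 0 then 2 * t else - 2 * t)) * indicator {a..b} t) (x\<^sup>2)" by simp
  have "AE t in lborel. (2 * \<bar>x\<bar> - (if x \<ge> 0 then 2 * t else - 2 * t)) * indicator {a..b} t
      = \<bar>x - t\<bar> - \<bar>t\<bar> + x * (if t \<le> 0 then -1 else 1)"
    using AE_lborel_singleton[of 0]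
    by eventually_elim (auto simp: a_def b_def indicator_def min_def max_def abs_if)
  then show ?thesis using *
    by (subst (asm) has_bochner_integral_cong_AE[where g = "\<lambda>t. \<bar>x - t\<bar> - \<bar>t\<bar> + x * (if t \<le> 0 then -1 else 1)"]) auto
qed

lemma abs_kernel_nonneg: "0 \<le> \<bar>x - t\<bar> - \<bar>t\<bar> + x * (if t \<le> 0 then -1 else (1::real))"
  by (auto simp: abs_if)

lemma abs_product_kernel_nonneg: "0 \<le> \<bar>x - t\<bar> * \<bar>y - t\<bar> - (x - t) * (y - (t::real))"
  using abs_ge_self[of "(x - t) * (y - t)"] by (simp add: abs_mult)

context prob_space
begin

text \<open>Integrate \<open>abs_kernel\<close> over the law of \<open>X\<close> and exchange the integrals.\<close>

lemma integral_of_abs_deviation: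
  fixes X :: "'a \<Rightarrow> real"
  assumes X[measurable]: "X \<in> borel_measurable M" and i2: "integrable M (\<lambda>x. (X x)\<^sup>2)"
    and i1: "integrable M X" and mean: "expectation X = 0"
  shows "has_bochner_integral lborel (\<lambda>t. expectation (\<lambda>x. \<bar>X x - t\<bar>) - \<bar>t\<bar>) (expectation (\<lambda>x. (X x)\<^sup>2))"
proof -
  define k where "k x t = \<bar>X x - t\<bar> - \<bar>t\<bar> + X x * (if t \<le> 0 then -1 else 1)" for x t
  interpret Q: pair_sigma_finite M lborel ..
  have km: "(\<lambda>(x, t). ennreal (k x t)) \<in> borel_measurable (M \<Otimes>\<^sub>M lborel)"
    unfolding k_def by measurable
  have hi: "has_bochner_integral M (\<lambda>x. k x t) (expectation (\<lambda>x. \<bar>X x - t\<bar>) - \<bar>t\<bar>)" for t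
  proof -
    have "has_bochner_integral M (\<lambda>x. k x t) (expectation (\<lambda>x. \<bar>X x - t\<bar>) - \<bar>t\<bar> + 0 * (if t \<le> 0 then -1 else 1))"
      unfolding k_def using i1 mean
      by (intro has_bochner_integral_add has_bochner_integral_diff has_bochner_integral_mult_left)
        (auto simp: has_bochner_integral_iff prob_space)
    then show ?thesis by simp
  qed
  have k0: "0 \<le> k x t" for x t unfolding k_def by (rule abs_kernel_nonneg)
  have "(\<integral>\<^sup>+t. ennreal (expectation (\<lambda>x. \<bar>X x - t\<bar>) - \<bar>t\<bar>) \<partial>lborel) = (\<integral>\<^sup>+t. (\<integral>\<^sup>+x. ennreal (k x t) \<partial>M) \<partial>lborel)"
    using nn_integral_of_has_bochner_integral[OF hi k0] by simp
  also have "\<dots> = (\<integral>\<^sup>+x. (\<integral>\<^sup>+t. ennreal (k x t) \<partial>lborel) \<partial>M)"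
    by (rule Q.Fubini'[OF km])
  also have "\<dots> = (\<integral>\<^sup>+x. ennreal ((X x)\<^sup>2) \<partial>M)"
    using nn_integral_of_has_bochner_integral[OF abs_kernel abs_kernel_nonneg] unfolding k_def by simp
  also have "\<dots> = ennreal (expectation (\<lambda>x. (X x)\<^sup>2))" using i2 by (simp add: nn_integral_eq_integral)
  finally have I: "(\<integral>\<^sup>+t. ennreal (expectation (\<lambda>x. \<bar>X x - t\<bar>) - \<bar>t\<bar>) \<partial>lborel) = ennreal (expectation (\<lambda>x. (X x)\<^sup>2))" .
  have nn: "0 \<le> expectation (\<lambda>x. \<bar>X x - t\<bar>) - \<bar>t\<bar>" for t
    unfolding has_bochner_integral_integral_eq[OF hi, symmetric] by (rule integral_nonneg_AE) (simp add: k0)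
  show ?thesis
    by (rule has_bochner_integral_nn_integral[OF _ _ _ I]) (use nn in auto)
qed

text \<open>Integrate \<open>abs_product_kernel\<close> over two independent copies of \<open>X\<close>: the products factor into squares of
\<open>E |X - t|\<close> and of \<open>E (X - t) = - t\<close>.\<close>

lemma integral_of_abs_deviation_squared:
  fixes X :: "'a \<Rightarrow> real"
  assumes X[measurable]: "X \<in> borel_measurable M" and i1: "integrable M X" and mean: "expectation X = 0"
    and i3: "integrable (M \<Otimes>\<^sub>M M) (\<lambda>z. \<bar>X (fst z) - X (snd z)\<bar> ^ 3)"
  shows "has_bochner_integral lborel (\<lambda>t. (expectation (\<lambda>x. \<bar>X x - t\<bar>))\<^sup>2 - t\<^sup>2)
     ((\<integral>z. \<bar>X (fst z) - X (snd z)\<bar> ^ 3 \<partial>(M \<Otimes>\<^sub>M M)) / 3)"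
proof -
  define k where "k z t = \<bar>X (fst z) - t\<bar> * \<bar>X (snd z) - t\<bar> - (X (fst z) - t) * (X (snd z) - t)" for z t
  interpret P: pair_prob_space M M ..
  interpret Q: pair_sigma_finite "M \<Otimes>\<^sub>M M" lborel ..
  have km: "(\<lambda>(z, t). ennreal (k z t)) \<in> borel_measurable ((M \<Otimes>\<^sub>M M) \<Otimes>\<^sub>M lborel)"
    unfolding k_def by measurable
  have hi: "has_bochner_integral (M \<Otimes>\<^sub>M M) (\<lambda>z. k z t) ((expectation (\<lambda>x. \<bar>X x - t\<bar>))\<^sup>2 - t\<^sup>2)" for t
  proof -
    have "has_bochner_integral (M \<Otimes>\<^sub>M M) (\<lambda>z. k z t)
      (expectation (\<lambda>x. \<bar>X x - t\<bar>) * expectation (\<lambda>x. \<bar>X x - t\<bar>) - expectation (\<lambda>x. X x - t) * expectation (\<lambda>x. X x - t))"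
      unfolding k_def using i1
      by (intro has_bochner_integral_diff has_bochner_integral_pair_product[OF prob_space_axioms]) auto
    then show ?thesis using i1 mean by (simp add: power2_eq_square prob_space)
  qed
  have k0: "0 \<le> k z t" for z t unfolding k_def by (rule abs_product_kernel_nonneg)
  have "(\<integral>\<^sup>+t. ennreal ((expectation (\<lambda>x. \<bar>X x - t\<bar>))\<^sup>2 - t\<^sup>2) \<partial>lborel) = (\<integral>\<^sup>+t. (\<integral>\<^sup>+z. ennreal (k z t) \<partial>(M \<Otimes>\<^sub>M M)) \<partial>lborel)"
    using nn_integral_of_has_bochner_integral[OF hi k0] by simp
  also have "\<dots> = (\<integral>\<^sup>+z. (\<integral>\<^sup>+t. ennreal (k z t) \<partial>lborel) \<partial>(M \<Otimes>\<^sub>M M))"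
    by (rule Q.Fubini'[OF km])
  also have "\<dots> = (\<integral>\<^sup>+z. ennreal (\<bar>X (fst z) - X (snd z)\<bar> ^ 3 / 3) \<partial>(M \<Otimes>\<^sub>M M))"
    using nn_integral_of_has_bochner_integral[OF abs_product_kernel abs_product_kernel_nonneg] unfolding k_def by simp
  also have "\<dots> = ennreal ((\<integral>z. \<bar>X (fst z) - X (snd z)\<bar> ^ 3 \<partial>(M \<Otimes>\<^sub>M M)) / 3)"
    using i3 by (subst nn_integral_eq_integral) auto
  finally have I: "(\<integral>\<^sup>+t. ennreal ((expectation (\<lambda>x. \<bar>X x - t\<bar>))\<^sup>2 - t\<^sup>2) \<partial>lborel) = ennreal ((\<integral>z. \<bar>X (fst z) - X (snd z)\<bar> ^ 3 \<partial>(M \<Otimes>\<^sub>M M)) / 3)" .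
  have nn: "0 \<le> (expectation (\<lambda>x. \<bar>X x - t\<bar>))\<^sup>2 - t\<^sup>2" for t
    unfolding has_bochner_integral_integral_eq[OF hi, symmetric] by (rule integral_nonneg_AE) (simp add: k0)
  show ?thesis
    by (rule has_bochner_integral_nn_integral[OF _ _ _ I]) (use nn in auto)
qed

text \<open>With \<open>h t = E |X - t|\<close>, one third of the functional is the integral of
\<open>(h\<^sup>2 - t\<^sup>2) - (h - |t|) = (h - 1/2)\<^sup>2 - (|t| - 1/2)\<^sup>2\<close>. Outside \<open>[-1/2, 1/2]\<close> this is nonnegative, as
\<open>h \<ge> |t|\<close> by Jensen; inside, the subtracted square integrates to \<open>1 / 12\<close>, so the minimum of the
functional is \<open>- 1 / 4\<close>. If \<open>h\<close> were at distance \<open>d\<close> from \<open>1 / 2\<close> at \<open>t0\<close>, then at distance \<open>d / 2\<close> on an interval of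
length \<open>d / 2\<close>, since \<open>h\<close> is 1-Lipschitz, and this would cost \<open>(d / 2)\<^sup>2 * (d / 2) = d ^ 3 / 8\<close>.\<close>

lemma abs_deviation_near_half:
  fixes X :: "'a \<Rightarrow> real" and d t0 :: real
  assumes X[measurable]: "X \<in> borel_measurable M" and i2: "integrable M (\<lambda>x. (X x)\<^sup>2)"
    and i1: "integrable M X" and mean: "expectation X = 0"
    and i3: "integrable (M \<Otimes>\<^sub>M M) (\<lambda>z. \<bar>X (fst z) - X (snd z)\<bar> ^ 3)"
    and J: "(\<integral>z. \<bar>X (fst z) - X (snd z)\<bar> ^ 3 \<partial>(M \<Otimes>\<^sub>M M)) - 3 * expectation (\<lambda>x. (X x)\<^sup>2) < - 1 / 4 + 3 * d ^ 3 / 8"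
    and d: "0 < d" "d \<le> 1" and t0: "\<bar>t0\<bar> \<le> 1 / 2"
  shows "\<bar>expectation (\<lambda>x. \<bar>X x - t0\<bar>) - 1 / 2\<bar> < d"
proof (rule ccontr)
  assume far: "\<not> ?thesis"
  define h where "h t = expectation (\<lambda>x. \<bar>X x - t\<bar>)" for t
  have habs: "\<bar>t\<bar> \<le> h t" for t
  proof -
    have "t = expectation (\<lambda>x. t - X x)" using i1 mean by (simp add: prob_space)
    then have "\<bar>t\<bar> \<le> expectation (\<lambda>x. \<bar>t - X x\<bar>)" by (metis integral_abs_bound)
    then show ?thesis by (simp add: h_def abs_minus_commute)
  qed
  have hlip: "\<bar>h t - h s\<bar> \<le> \<bar>t - s\<bar>" for t s
  proof -
    have "h t - h s = expectation (\<lambda>x. \<bar>X x - t\<bar> - \<bar>X x - s\<bar>)" unfolding h_def using i1 by simp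
    also have "\<bar>\<dots>\<bar> \<le> expectation (\<lambda>x. \<bar>\<bar>X x - t\<bar> - \<bar>X x - s\<bar>\<bar>)" by (rule integral_abs_bound)
    also have "\<dots> \<le> expectation (\<lambda>x. \<bar>t - s\<bar>)" using i1 by (intro integral_mono) auto
    finally show ?thesis by (simp add: prob_space)
  qed
  define a where "a = (if t0 \<le> 0 then t0 else t0 - d / 2)"
  have I: "{a..a + d / 2} \<subseteq> {-1/2..1/2}" "\<And>t. t \<in> {a..a + d / 2} \<Longrightarrow> \<bar>t - t0\<bar> \<le> d / 2"
    using t0 d by (auto simp: a_def split: if_splits)
  define G where "G t = ((h t)\<^sup>2 - t\<^sup>2) - (h t - \<bar>t\<bar>)" for t
  \<comment> \<open>A minorant of \<open>G\<close> with an explicit integral. At \<open>t = 0\<close> both squares are subtracted,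
    which only lowers it.\<close>
  define L where "L t = d\<^sup>2 / 4 * indicator {a..a + d / 2} t - ((t + 1/2)\<^sup>2 * indicator {-1/2..0} t + (t - 1/2)\<^sup>2 * indicator {0..1/2} t)" for t :: real
  have G: "has_bochner_integral lborel G ((\<integral>z. \<bar>X (fst z) - X (snd z)\<bar> ^ 3 \<partial>(M \<Otimes>\<^sub>M M)) / 3 - expectation (\<lambda>x. (X x)\<^sup>2))"
    unfolding G_def h_def
    by (intro has_bochner_integral_diff integral_of_abs_deviation integral_of_abs_deviation_squared assms)
  have L: "has_bochner_integral lborel L (d\<^sup>2 / 4 * (d / 2) - (1 / 24 + 1 / 24))"
    unfolding L_def
  proof (intro has_bochner_integral_diff has_bochner_integral_add has_bochner_integral_mult_right)
    show "has_bochner_integral lborel (indicator {a..a + d / 2}) (d / 2)"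
      using d has_bochner_integral_real_indicator[of "{a..a + d/2}" lborel] by (simp add: emeasure_lborel_Icc_eq)
    have "has_bochner_integral lborel (\<lambda>t. (t + 1/2)\<^sup>2 * indicator {-1/2..0::real} t) ((0 + 1/2) ^ 3 / 3 - (-1/2 + 1/2) ^ 3 / 3)"
      by (rule has_bochner_integral_FTC_Icc_real) (auto intro!: derivative_eq_intros continuous_intros)
    then show "has_bochner_integral lborel (\<lambda>t. (t + 1/2)\<^sup>2 * indicator {-1/2..0::real} t) (1 / 24)" by (simp add: power3_eq_cube)
    have "has_bochner_integral lborel (\<lambda>t. (t - 1/2)\<^sup>2 * indicator {0..1/2::real} t) ((1/2 - 1/2) ^ 3 / 3 - (0 - 1/2) ^ 3 / 3)"
      by (rule has_bochner_integral_FTC_Icc_real) (auto intro!: derivative_eq_intros continuous_intros)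
    then show "has_bochner_integral lborel (\<lambda>t. (t - 1/2)\<^sup>2 * indicator {0..1/2::real} t) (1 / 24)" by (simp add: power3_eq_cube)
  qed
  have LG: "L t \<le> G t" for t
  proof -
    have Gt: "G t = (h t - 1/2)\<^sup>2 - (\<bar>t\<bar> - 1/2)\<^sup>2"
      by (simp add: G_def power2_eq_square algebra_simps)
    show ?thesis
    proof (cases "t \<in> {-1/2..1/2}")
      case True
      then have "(\<bar>t\<bar> - 1/2)\<^sup>2 \<le> (t + 1/2)\<^sup>2 * indicator {-1/2..0} t + (t - 1/2)\<^sup>2 * indicator {0..1/2} t"
        by (auto simp: indicator_def abs_if power2_eq_square algebra_simps)
      moreover have "d\<^sup>2 / 4 * indicator {a..a + d / 2} t \<le> (h t - 1/2)\<^sup>2"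
      proof (cases "t \<in> {a..a + d / 2}")
        case True
        have "d \<le> \<bar>h t0 - 1/2\<bar>" using far by (simp add: h_def)
        then have "d / 2 \<le> \<bar>h t - 1/2\<bar>" using hlip[of t t0] I(2)[OF True] by linarith
        then have "(d / 2)\<^sup>2 \<le> \<bar>h t - 1/2\<bar>\<^sup>2" using d by (intro power_mono) auto
        then show ?thesis using True by (simp add: power2_eq_square)
      qed simp
      ultimately show ?thesis unfolding L_def Gt by linarith
    next
      case False
      then have "L t = 0" using I(1) by (auto simp: L_def indicator_def)
      moreover have "\<bar>\<bar>t\<bar> - 1/2\<bar> \<le> \<bar>h t - 1/2\<bar>" using habs[of t] False by auto
      then have "(\<bar>t\<bar> - 1/2)\<^sup>2 \<le> (h t - 1/2)\<^sup>2" using abs_le_square_iff by blast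
      ultimately show ?thesis unfolding Gt by simp
    qed
  qed
  have "d\<^sup>2 / 4 * (d / 2) - (1 / 24 + 1 / 24) \<le> (\<integral>z. \<bar>X (fst z) - X (snd z)\<bar> ^ 3 \<partial>(M \<Otimes>\<^sub>M M)) / 3 - expectation (\<lambda>x. (X x)\<^sup>2)"
    using has_bochner_integral_integral_eq[OF L] has_bochner_integral_integral_eq[OF G]
      integral_mono[of lborel L G] L G LG by (simp add: has_bochner_integral_iff)
  then show False using J by (simp add: power2_eq_square power3_eq_cube)
qed

end

lemma limit_kernel_ge_cubic:
  fixes \<alpha> r :: real
  assumes \<alpha>: "\<alpha> \<ge> 3" and r: "r \<ge> 0"
  shows "2 * (1 / 2 - 1 / \<alpha>) * (r ^ 3 - 3 / 2 * r\<^sup>2) \<le> r powr \<alpha> / \<alpha> - r\<^sup>2 / 2"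
proof -
  have "tangent_coeff \<alpha> 3 = 2 * (1 / 2 - 1 / \<alpha>)" using \<alpha> by (simp add: tangent_coeff_def field_simps)
  then show ?thesis
    using power_gap_nonneg[of 3 \<alpha> r] r \<alpha> unfolding power_gap_def
    by (cases "r = 0") (simp_all add: powr_numeral)
qed

text \<open>For centered \<open>X\<close> the distance of \<open>|X|\<close> to \<open>1 / 2\<close> is, on average, a signed combination of the
deviations \<open>E |X - t| - 1 / 2\<close> at \<open>t = 0\<close>, \<open>1 / 2\<close> and \<open>-1 / 2\<close>.\<close>

lemma (in prob_space) abs_value_concentrates_at_half:
  fixes X :: "'a \<Rightarrow> real"
  assumes i1: "integrable M X" and mean: "expectation X = 0" and s: "s > 0"
    and h: "\<And>t. \<bar>t\<bar> \<le> 1 / 2 \<Longrightarrow> \<bar>expectation (\<lambda>x. \<bar>X x - t\<bar>) - 1 / 2\<bar> < d"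
  shows "prob {x \<in> space M. s \<le> \<bar>\<bar>X x\<bar> - 1 / 2\<bar>} \<le> 3 * d / s"
proof -
  have eq: "\<bar>\<bar>u\<bar> - 1 / 2\<bar> = 1 / 2 - \<bar>u - 0\<bar> + (\<bar>u - 1 / 2\<bar> - (1 / 2 - u)) + (\<bar>u - (- 1 / 2)\<bar> - (1 / 2 + u))" for u :: real
    by (auto simp: abs_if)
  have i: "integrable M (\<lambda>x. \<bar>\<bar>X x\<bar> - 1 / 2\<bar>)" using i1 by simp
  have "expectation (\<lambda>x. \<bar>\<bar>X x\<bar> - 1 / 2\<bar>) =
      1 / 2 - expectation (\<lambda>x. \<bar>X x - 0\<bar>) + (expectation (\<lambda>x. \<bar>X x - 1 / 2\<bar>) - (1 / 2 - expectation X))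
       + (expectation (\<lambda>x. \<bar>X x - (- 1 / 2)\<bar>) - (1 / 2 + expectation X))"
    unfolding eq using i1 by (simp add: prob_space)
  also have "\<dots> \<le> 3 * d" using h[of 0] h[of "1/2"] h[of "-1/2"] mean by simp
  finally have I: "expectation (\<lambda>x. \<bar>\<bar>X x\<bar> - 1 / 2\<bar>) \<le> 3 * d" .
  have "prob {x \<in> space M. s \<le> \<bar>\<bar>X x\<bar> - 1 / 2\<bar>} \<le> expectation (\<lambda>x. \<bar>\<bar>X x\<bar> - 1 / 2\<bar>) / s"
    by (rule integral_Markov_inequality_measure[OF i sets.empty_sets _ s]) simp
  also have "\<dots> \<le> 3 * d / s" using I s by (intro divide_right_mono) auto
  finally show ?thesis .
qed

text \<open>Here the conclusion comes from the rigidity of the cubic minorant alone, which also covers \<open>\<alpha> = 3\<close>: if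
two independent copies of \<open>X\<close> are each within \<open>e / 2\<close> of \<open>1 / 2\<close> or \<open>-1 / 2\<close>, then their distance is
within \<open>e\<close> of 0 or 1.\<close>

lemma off_simplex_small_of_cubic_growth:
  fixes e \<eta> \<alpha> :: real
  assumes dim: "DIM('a::euclidean_space) = 1" and \<alpha>: "\<alpha> \<ge> 3" and e: "0 < e" and \<eta>: "\<eta> > 0"
  shows "\<exists>\<delta>>0. \<forall>M :: 'a measure. has_distance_moment \<alpha> M \<longrightarrow> (\<integral>x. x \<partial>M) = 0 \<longrightarrow>
     limit_energy \<alpha> M \<le> - (1 / 2 - 1 / \<alpha>) * (DIM('a) / (DIM('a) + 1)) + \<delta> \<longrightarrow>
     measure (M \<Otimes>\<^sub>M M) (off_simplex e) \<le> \<eta>"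
proof -
  obtain b :: 'a where Basis: "Basis = {b}" using dim by (auto simp: card_1_singleton_iff)
  have norm_b: "norm x = \<bar>x \<bullet> b\<bar>" for x :: 'a
    unfolding norm_eq_sqrt_inner euclidean_inner[of x x] Basis by (simp add: real_sqrt_mult_self)
  define d where "d = min 1 (\<eta> * e / 12)"
  have d: "0 < d" "d \<le> 1" "12 * d / e \<le> \<eta>" using e \<eta> by (auto simp: d_def min_def field_simps)
  define \<kappa> where "\<kappa> = 1 / 2 - 1 / \<alpha>"
  have \<kappa>: "\<kappa> > 0" using \<alpha> by (simp add: \<kappa>_def field_simps)
  have gap: "2 * \<kappa> * (r ^ 3 - 3 / 2 * r\<^sup>2) \<le> r powr \<alpha> / \<alpha> - r\<^sup>2 / 2" if "r \<ge> 0" for r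
    unfolding \<kappa>_def by (rule limit_kernel_ge_cubic[OF \<alpha> that])
  define \<delta> where "\<delta> = \<kappa> * (3 * d ^ 3 / 8)"
  have \<delta>: "\<delta> > 0" using \<kappa> d by (simp add: \<delta>_def)
  have "measure (M \<Otimes>\<^sub>M M) (off_simplex e) \<le> \<eta>"
    if D: "has_distance_moment \<alpha> M" and mean: "(\<integral>x. x \<partial>M) = 0"
      and J: "limit_energy \<alpha> M \<le> - (1 / 2 - 1 / \<alpha>) * (DIM('a) / (DIM('a) + 1)) + \<delta>"
    for M :: "'a measure"
  proof -
    have M: "M \<in> prob_measures" using D by (simp add: has_distance_moment_def)
    interpret prob_space M using M by (simp add: prob_measures_iff)
    interpret P: pair_prob_space M M ..
    have sM[measurable_cong]: "sets M = sets borel" using M by (auto simp: prob_measures_iff)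
    define X where "X x = x \<bullet> b" for x
    have Xm[measurable]: "X \<in> borel_measurable M" unfolding X_def by measurable
    have distX: "dist x y = \<bar>X x - X y\<bar>" for x y
      by (simp add: dist_norm norm_b X_def inner_diff_left)
    have "integrable M (\<lambda>x. norm x)" using integrable_norm_power[OF D, of 1] \<alpha> by simp
    then have ix: "integrable M (\<lambda>x. x)" by (rule integrable_norm_cancel) simp
    have i1: "integrable M X" unfolding X_def using ix by simp
    have mX: "expectation X = 0" unfolding X_def using integral_inner_left[of b M "\<lambda>x. x"] ix mean by simp
    have i2: "integrable M (\<lambda>x. (X x)\<^sup>2)"
      using integrable_norm_power[OF D, of 2] \<alpha> by (simp add: norm_b X_def)
    have i3: "integrable (M \<Otimes>\<^sub>M M) (\<lambda>z. \<bar>X (fst z) - X (snd z)\<bar> ^ 3)"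
      using integrable_dist_power[OF D, of 3] \<alpha> by (simp add: distX)
    define V where "V = expectation (\<lambda>x. (X x)\<^sup>2)"
    define S where "S = (\<integral>z. \<bar>X (fst z) - X (snd z)\<bar> ^ 3 \<partial>(M \<Otimes>\<^sub>M M))"
    have sq: "has_bochner_integral (M \<Otimes>\<^sub>M M) (\<lambda>z. (dist (fst z) (snd z))\<^sup>2) (2 * V)"
    proof -
      have one: "integrable M (\<lambda>x. 1 :: real)" by simp
      note hp = has_bochner_integral_pair_product[OF prob_space_axioms]
      have "has_bochner_integral (M \<Otimes>\<^sub>M M)
         (\<lambda>z. (X (fst z))\<^sup>2 * 1 + 1 * (X (snd z))\<^sup>2 - 2 * (X (fst z) * X (snd z)))
         (V * expectation (\<lambda>x. 1) + expectation (\<lambda>x. 1) * V - 2 * (expectation X * expectation X))"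
        unfolding V_def
        by (intro has_bochner_integral_add has_bochner_integral_diff hp one i1 i2
            has_bochner_integral_mult_right[OF hp[OF i1 i1]])
      moreover have "(\<lambda>z. (X (fst z))\<^sup>2 * 1 + 1 * (X (snd z))\<^sup>2 - 2 * (X (fst z) * X (snd z))) = (\<lambda>z. (dist (fst z) (snd z))\<^sup>2)"
        by (rule ext) (simp add: distX power2_diff)
      ultimately show ?thesis by (simp add: mX prob_space)
    qed
    have "2 * \<kappa> * (S - 3 * V) = (\<integral>z. 2 * \<kappa> * (dist (fst z) (snd z) ^ 3 - 3 / 2 * (dist (fst z) (snd z))\<^sup>2) \<partial>(M \<Otimes>\<^sub>M M))"
      using sq i3 by (simp add: has_bochner_integral_iff S_def distX)
    also have "\<dots> \<le> limit_energy \<alpha> M"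
      unfolding limit_energy_def
    proof (rule integral_mono)
      show "integrable (M \<Otimes>\<^sub>M M) (\<lambda>z. 2 * \<kappa> * (dist (fst z) (snd z) ^ 3 - 3 / 2 * (dist (fst z) (snd z))\<^sup>2))"
        using integrable_dist_power[OF D, of 3] integrable_dist_power[OF D, of 2] \<alpha> by simp
      show "integrable (M \<Otimes>\<^sub>M M) (\<lambda>z. dist (fst z) (snd z) powr \<alpha> / \<alpha> - (dist (fst z) (snd z))\<^sup>2 / 2)"
        using integrable_dist_powr[OF D, of \<alpha>] integrable_dist_power[OF D, of 2] \<alpha> by simp
    qed (rule gap, simp)
    also have "\<dots> \<le> 2 * \<kappa> * (- 1 / 4 + 3 * d ^ 3 / 16)"
      using J unfolding dim \<kappa>_def[symmetric] \<delta>_def by (simp add: algebra_simps)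
    also have "\<dots> < 2 * \<kappa> * (- 1 / 4 + 3 * d ^ 3 / 8)" using \<kappa>(1) d(1) by (intro mult_strict_left_mono) auto
    finally have small: "S - 3 * V < - 1 / 4 + 3 * d ^ 3 / 8" using \<kappa>(1) by simp
    have half: "\<bar>expectation (\<lambda>x. \<bar>X x - t\<bar>) - 1 / 2\<bar> < d" if "\<bar>t\<bar> \<le> 1 / 2" for t
      by (rule abs_deviation_near_half[OF Xm i2 i1 mX i3 small[unfolded S_def V_def] d(1,2) that])
    define Z where "Z = {x \<in> space M. e / 2 \<le> \<bar>\<bar>X x\<bar> - 1 / 2\<bar>}"
    have Zs: "Z \<in> sets M" unfolding Z_def by measurable
    have sp: "space M = UNIV" by (rule space_prob_measures[OF M])
    have Z: "prob Z \<le> 3 * d / (e / 2)"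
      unfolding Z_def by (rule abs_value_concentrates_at_half[OF i1 mX _ half]) (use e in auto)
    have "measure (M \<Otimes>\<^sub>M M) (off_simplex e) \<le> measure (M \<Otimes>\<^sub>M M) (Z \<times> UNIV \<union> UNIV \<times> Z)"
    proof (rule P.finite_measure_mono)
      show "off_simplex e \<subseteq> Z \<times> UNIV \<union> UNIV \<times> Z"
      proof (rule subsetI, rule ccontr)
        fix z assume z: "z \<in> off_simplex e" "z \<notin> Z \<times> UNIV \<union> UNIV \<times> Z"
        then have "\<bar>\<bar>X (fst z)\<bar> - 1 / 2\<bar> < e / 2" "\<bar>\<bar>X (snd z)\<bar> - 1 / 2\<bar> < e / 2"
          by (auto simp: Z_def sp mem_Times_iff)
        then show False using z(1) unfolding distX by (auto simp: abs_if split: if_splits)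
      qed
      show "Z \<times> UNIV \<union> UNIV \<times> Z \<in> sets (M \<Otimes>\<^sub>M M)"
        using Zs sets.top[of M] unfolding sp by (intro sets.Un pair_measureI)
    qed
    also have "\<dots> \<le> measure (M \<Otimes>\<^sub>M M) (Z \<times> UNIV) + measure (M \<Otimes>\<^sub>M M) (UNIV \<times> Z)"
      using Zs sets.top[of M] unfolding sp by (intro measure_Un_le pair_measureI)
    also have "\<dots> = 2 * prob Z"
      using Zs sets.top[of M] prob_space unfolding sp
      by (simp add: measure_def emeasure_pair_measure_Times enn2real_mult)
    also have "\<dots> \<le> 12 * d / e" using Z e by (simp add: field_simps)
    finally show ?thesis using d(3) by linarith
  qed
  then show ?thesis using \<delta> by (intro exI[of _ \<delta>]) simp
qed

section \<open>Near-diagonal mass and first moment\<close>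

lemma limit_kernel_ge:
  fixes \<alpha> r :: real
  assumes \<alpha>: "\<alpha> \<ge> 3" and r: "r \<ge> 0"
  shows "- (1 / 2 - 1 / \<alpha>) \<le> r powr \<alpha> / \<alpha> - r\<^sup>2 / 2"
proof -
  define \<kappa> where "\<kappa> = 1 / 2 - 1 / \<alpha>"
  have \<kappa>: "\<kappa> > 0" using \<alpha> by (simp add: \<kappa>_def field_simps)
  have "2 * \<kappa> * (r ^ 3 - 3 / 2 * r\<^sup>2) \<le> r powr \<alpha> / \<alpha> - r\<^sup>2 / 2"
    unfolding \<kappa>_def by (rule limit_kernel_ge_cubic[OF \<alpha> r])
  moreover have "2 * \<kappa> * (r ^ 3 - 3 / 2 * r\<^sup>2) + \<kappa> = 2 * \<kappa> * ((r - 1)\<^sup>2 * (r + 1 / 2))"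
    by (simp add: power2_eq_square power3_eq_cube algebra_simps)
  moreover have "0 \<le> 2 * \<kappa> * ((r - 1)\<^sup>2 * (r + 1 / 2))" using \<kappa> r by simp
  ultimately show ?thesis unfolding \<kappa>_def[symmetric] by linarith
qed

lemma integrable_limit_kernel:
  fixes M :: "'a::euclidean_space measure"
  assumes "\<alpha> \<ge> 3" "has_distance_moment \<alpha> M"
  shows "integrable (M \<Otimes>\<^sub>M M) (\<lambda>z. dist (fst z) (snd z) powr \<alpha> / \<alpha> - (dist (fst z) (snd z))\<^sup>2 / 2)"
  using integrable_dist_powr[OF assms(2), of \<alpha>] integrable_dist_power[OF assms(2), of 2] assms by simp

text \<open>The kernel is at least \<open>- \<kappa>\<close> everywhere and at least \<open>- \<rho>\<^sup>2 / 2\<close> at distances up to \<open>\<rho>\<close>, so pairs of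
close points raise the energy by almost \<open>\<kappa>\<close> times their probability.\<close>

lemma near_diagonal_mass_le:
  fixes M :: "'a::euclidean_space measure" and \<rho> \<delta> \<alpha> :: real
  assumes \<alpha>: "\<alpha> \<ge> 3" and D: "has_distance_moment \<alpha> M" and \<rho>: "0 < \<rho>"
    and J: "limit_energy \<alpha> M \<le> - (1 / 2 - 1 / \<alpha>) * (DIM('a) / (DIM('a) + 1)) + \<delta>"
  shows "measure (M \<Otimes>\<^sub>M M) {z. dist (fst z) (snd z) \<le> \<rho>} \<le> 1 / (DIM('a) + 1) + (\<delta> + \<rho>\<^sup>2 / 2) / (1 / 2 - 1 / \<alpha>)"
proof -
  have M: "M \<in> prob_measures" using D by (simp add: has_distance_moment_def)
  interpret prob_space M using M by (simp add: prob_measures_iff)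
  interpret P: pair_prob_space M M ..
  define \<kappa> where "\<kappa> = 1 / 2 - 1 / \<alpha>"
  have \<kappa>: "\<kappa> > 0" using \<alpha> by (simp add: \<kappa>_def field_simps)
  let ?A = "{z::'a \<times> 'a. dist (fst z) (snd z) \<le> \<rho>}"
  have A: "?A \<in> sets (M \<Otimes>\<^sub>M M)" by (rule distance_event_measurable[OF M]) simp
  have iA: "integrable (M \<Otimes>\<^sub>M M) (indicator ?A :: _ \<Rightarrow> real)"
    by (rule P.integrable_const_bound[of _ 1]) (use A in auto)
  have "- \<kappa> - \<rho>\<^sup>2 / 2 + \<kappa> * measure (M \<Otimes>\<^sub>M M) ?A = (\<integral>z. - \<kappa> - \<rho>\<^sup>2 / 2 + \<kappa> * indicator ?A z \<partial>(M \<Otimes>\<^sub>M M))"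
    using iA A by (simp add: P.prob_space)
  also have "\<dots> \<le> limit_energy \<alpha> M"
    unfolding limit_energy_def
  proof (intro integral_mono integrable_limit_kernel[OF \<alpha> D])
    show "integrable (M \<Otimes>\<^sub>M M) (\<lambda>z. - \<kappa> - \<rho>\<^sup>2 / 2 + \<kappa> * indicator ?A z)" using iA by simp
    fix z :: "'a \<times> 'a"
    have k: "- \<kappa> \<le> dist (fst z) (snd z) powr \<alpha> / \<alpha> - (dist (fst z) (snd z))\<^sup>2 / 2"
      unfolding \<kappa>_def by (rule limit_kernel_ge[OF \<alpha>]) simp
    show "- \<kappa> - \<rho>\<^sup>2 / 2 + \<kappa> * indicator ?A z \<le> dist (fst z) (snd z) powr \<alpha> / \<alpha> - (dist (fst z) (snd z))\<^sup>2 / 2"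
    proof (cases "z \<in> ?A")
      case True
      then have "(dist (fst z) (snd z))\<^sup>2 \<le> \<rho>\<^sup>2" by (intro power_mono) auto
      moreover have "0 \<le> dist (fst z) (snd z) powr \<alpha> / \<alpha>" using \<alpha> by simp
      ultimately have "- (\<rho>\<^sup>2 / 2) \<le> dist (fst z) (snd z) powr \<alpha> / \<alpha> - (dist (fst z) (snd z))\<^sup>2 / 2" by linarith
      then show ?thesis using True by simp
    next
      case False
      have "0 \<le> \<rho>\<^sup>2 / 2" by simp
      then have "- \<kappa> - \<rho>\<^sup>2 / 2 \<le> dist (fst z) (snd z) powr \<alpha> / \<alpha> - (dist (fst z) (snd z))\<^sup>2 / 2" using k by linarith
      then show ?thesis using False by simp
    qed
  qed
  also have "\<dots> \<le> - \<kappa> * (DIM('a) / (DIM('a) + 1)) + \<delta>" using J by (simp add: \<kappa>_def)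
  also have "\<dots> = - \<kappa> + \<kappa> * (1 / (DIM('a) + 1)) + \<delta>" by (simp add: divide_simps) (simp add: algebra_simps)
  finally have "\<kappa> * measure (M \<Otimes>\<^sub>M M) ?A \<le> \<kappa> * (1 / (DIM('a) + 1)) + (\<delta> + \<rho>\<^sup>2 / 2)" by linarith
  then have "measure (M \<Otimes>\<^sub>M M) ?A \<le> (\<kappa> * (1 / (DIM('a) + 1)) + (\<delta> + \<rho>\<^sup>2 / 2)) / \<kappa>"
    using \<kappa> by (simp add: le_divide_eq mult.commute)
  also have "\<dots> = 1 / (DIM('a) + 1) + (\<delta> + \<rho>\<^sup>2 / 2) / \<kappa>" using \<kappa> by (simp add: add_divide_distrib)
  finally show ?thesis unfolding \<kappa>_def .
qed

lemma square_le_powr: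
  fixes \<alpha> r :: real
  assumes "\<alpha> \<ge> 3" "r \<ge> 0"
  shows "r\<^sup>2 \<le> r powr \<alpha> / (2 * \<alpha>) + 4 * \<alpha>\<^sup>2"
proof (cases "r \<le> 2 * \<alpha>")
  case True
  then have "r\<^sup>2 \<le> (2 * \<alpha>)\<^sup>2" using assms by (intro power_mono) auto
  moreover have "0 \<le> r powr \<alpha> / (2 * \<alpha>)" using assms by simp
  ultimately show ?thesis by (simp add: power_mult_distrib)
next
  case False
  then have r: "r > 1" "2 * \<alpha> \<le> r" using assms by auto
  have "2 * \<alpha> * r\<^sup>2 \<le> r * r\<^sup>2" using r by (intro mult_right_mono) auto
  also have "\<dots> = r powr 3" using r by (simp add: powr_numeral power2_eq_square power3_eq_cube)
  also have "\<dots> \<le> r powr \<alpha>" using r assms by (intro powr_mono) auto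
  finally have "r\<^sup>2 \<le> r powr \<alpha> / (2 * \<alpha>)" using assms by (simp add: le_divide_eq mult_ac)
  then show ?thesis by (simp add: add_increasing2)
qed

text \<open>For a centered measure, \<open>|x|\<close> is at most the average of \<open>|x - y|\<close> over \<open>y\<close>, and the limit kernel
dominates the distance up to a constant.\<close>

lemma first_moment_le:
  fixes M :: "'a::euclidean_space measure"
  assumes \<alpha>: "\<alpha> \<ge> 3" and D: "has_distance_moment \<alpha> M" and mean: "(\<integral>x. x \<partial>M) = 0"
  shows "integrable M norm" "(\<integral>x. norm x \<partial>M) \<le> limit_energy \<alpha> M + (1 + 8 * \<alpha>\<^sup>2)"
proof -
  have M: "M \<in> prob_measures" using D by (simp add: has_distance_moment_def)
  interpret prob_space M using M by (simp add: prob_measures_iff)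
  interpret P: pair_prob_space M M ..
  show i: "integrable M norm" using integrable_norm_power[OF D, of 1] \<alpha> by simp
  have sM[measurable_cong]: "sets M = sets borel" using M by (auto simp: prob_measures_iff)
  have ix: "integrable M (\<lambda>x. x)" by (rule integrable_norm_cancel) (use i in simp_all)
  have d: "integrable (M \<Otimes>\<^sub>M M) (\<lambda>z. dist (fst z) (snd z))" using integrable_dist_power[OF D, of 1] \<alpha> by simp
  have "norm x \<le> (\<integral>y. dist x y \<partial>M)" for x
  proof -
    have "x = (\<integral>y. x - y \<partial>M)" using ix mean by (simp add: prob_space)
    then have "norm x \<le> (\<integral>y. norm (x - y) \<partial>M)" by (metis integral_norm_bound)
    then show ?thesis by (simp add: dist_norm)
  qed
  then have "(\<integral>x. norm x \<partial>M) \<le> (\<integral>x. (\<integral>y. dist x y \<partial>M) \<partial>M)"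
    using i P.integrable_fst'[OF d] by (intro integral_mono) auto
  also have "\<dots> = (\<integral>z. dist (fst z) (snd z) \<partial>(M \<Otimes>\<^sub>M M))" using P.integral_fst'[OF d] by simp
  also have "\<dots> \<le> (\<integral>z. (dist (fst z) (snd z) powr \<alpha> / \<alpha> - (dist (fst z) (snd z))\<^sup>2 / 2) + (1 + 8 * \<alpha>\<^sup>2) \<partial>(M \<Otimes>\<^sub>M M))"
  proof (rule integral_mono[OF d])
    show "integrable (M \<Otimes>\<^sub>M M) (\<lambda>z. (dist (fst z) (snd z) powr \<alpha> / \<alpha> - (dist (fst z) (snd z))\<^sup>2 / 2) + (1 + 8 * \<alpha>\<^sup>2))"
      using integrable_limit_kernel[OF \<alpha> D] by simp
    fix z :: "'a \<times> 'a"
    define r where "r = dist (fst z) (snd z)"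
    have "r\<^sup>2 \<le> r powr \<alpha> / (2 * \<alpha>) + 4 * \<alpha>\<^sup>2" by (rule square_le_powr[OF \<alpha>]) (simp add: r_def)
    moreover have "r powr \<alpha> / \<alpha> = 2 * (r powr \<alpha> / (2 * \<alpha>))" by simp
    moreover have "0 \<le> (r - 1)\<^sup>2" by simp
    then have "2 * r \<le> r\<^sup>2 + 1" unfolding power2_diff by simp
    moreover have "0 \<le> r\<^sup>2" by simp
    ultimately show "r \<le> (r powr \<alpha> / \<alpha> - r\<^sup>2 / 2) + (1 + 8 * \<alpha>\<^sup>2)" by linarith
  qed
  also have "\<dots> = limit_energy \<alpha> M + (1 + 8 * \<alpha>\<^sup>2)"
    unfolding limit_energy_def using integrable_limit_kernel[OF \<alpha> D] by (simp add: P.prob_space)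
  finally show "(\<integral>x. norm x \<partial>M) \<le> limit_energy \<alpha> M + (1 + 8 * \<alpha>\<^sup>2)" .
qed

section \<open>Minimizers of the energy\<close>

lemma powr_le_square:
  fixes b r :: real
  assumes b: "0 < b" "b \<le> 2" and r: "r \<ge> 0"
  shows "r powr b / b \<le> r\<^sup>2 / 2 + (1 / b - 1 / 2)"
proof -
  have "r powr b \<le> b / 2 * r\<^sup>2 + (1 - b / 2)"
  proof (cases "r = 0")
    case False
    then have "r powr b = (r\<^sup>2) powr (b / 2) * 1 powr (1 - b / 2)"
      using r by (simp add: powr_powr flip: powr_numeral)
    also have "\<dots> \<le> b / 2 * r\<^sup>2 + (1 - b / 2) * 1"
      by (rule Youngs_inequality_0) (use b False in auto)
    finally show ?thesis by simp
  qed (use b in simp)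
  then have "r powr b / b \<le> (b / 2 * r\<^sup>2 + (1 - b / 2)) / b" using b by (intro divide_right_mono) auto
  also have "\<dots> = r\<^sup>2 / 2 + (1 / b - 1 / 2)" using b by (simp add: field_simps)
  finally show ?thesis .
qed

lemma kernel_dist: "kernel \<alpha> b x y = dist x y powr \<alpha> / \<alpha> - dist x y powr b / b"
  by (simp add: kernel_def dist_norm)

lemma kernel_ge_limit_kernel:
  assumes "0 < b" "b \<le> 2"
  shows "dist x y powr \<alpha> / \<alpha> - (dist x y)\<^sup>2 / 2 - (1 / b - 1 / 2) \<le> kernel \<alpha> b x y"
  unfolding kernel_dist using powr_le_square[OF assms, of "dist x y"] by simp

lemma kernel_lower_bound:
  assumes "\<alpha> \<ge> 3" "0 < b" "b \<le> 2"
  shows "- (1 / b - 1 / \<alpha>) \<le> kernel \<alpha> b x y"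
  using limit_kernel_ge[OF assms(1), of "dist x y"] kernel_ge_limit_kernel[OF assms(2,3), of x y \<alpha>] by simp

lemma kernel_pair_measurable:
  fixes M :: "'a::euclidean_space measure"
  assumes "M \<in> prob_measures"
  shows "(\<lambda>z. kernel \<alpha> b (fst z) (snd z)) \<in> borel_measurable (M \<Otimes>\<^sub>M M)"
  unfolding kernel_dist by (rule dist_pair_measurable[OF assms]) simp

lemma energy_unit_simplex:
  fixes S :: "'a::euclidean_space set"
  assumes S: "finite S" "card S = DIM('a) + 1" "\<And>x y. x \<in> S \<Longrightarrow> y \<in> S \<Longrightarrow> x \<noteq> y \<Longrightarrow> dist x y = 1"
    and b: "0 < b" "b \<le> 2" "\<alpha> \<ge> 3"
  defines "\<nu> \<equiv> distr (uniform_count_measure S) borel (\<lambda>x. x)"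
  shows "\<nu> \<in> prob_measures"
    and "energy \<alpha> b \<nu> = ereal (- (1 / 2) * ((1 / b - 1 / \<alpha>) * (DIM('a) / (DIM('a) + 1))))"
proof -
  have ne: "S \<noteq> {}" using S(2) by auto
  have idm: "(\<lambda>x. x) \<in> measurable (uniform_count_measure S) borel"
    by (auto simp: measurable_def sets_uniform_count_measure space_uniform_count_measure)
  have p: "prob_space \<nu>" unfolding \<nu>_def
    by (rule prob_space.prob_space_distr[OF prob_space_uniform_count_measure[OF S(1) ne] idm])
  then show \<nu>: "\<nu> \<in> prob_measures" unfolding prob_measures_iff by (simp add: \<nu>_def)
  interpret prob_space \<nu> by (rule p)
  define N where "N = real DIM('a) + 1"
  have N: "N > 0" "real (card S) = N" "real DIM('a) = N - 1" by (simp_all add: N_def S(2))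
  define K where "K = 1 / b - 1 / \<alpha>"
  have K: "K \<ge> 0" using b by (simp add: K_def frac_le)
  have nn: "(\<integral>\<^sup>+x. f x \<partial>\<nu>) = (\<Sum>x\<in>S. ennreal (1 / N) * f x)" if "f \<in> borel_measurable borel" for f :: "'a \<Rightarrow> ennreal"
    unfolding \<nu>_def using that idm S(1)
    by (simp add: nn_integral_distr uniform_count_measure_def nn_integral_point_measure_finite N(2))
  have pair: "(\<integral>\<^sup>+z. ennreal (g (dist (fst z) (snd z))) \<partial>(\<nu> \<Otimes>\<^sub>M \<nu>)) = (\<Sum>x\<in>S. \<Sum>y\<in>S. ennreal (1 / N) * (ennreal (1 / N) * ennreal (g (dist x y))))"
    if [measurable]: "g \<in> borel_measurable borel" for g :: "real \<Rightarrow> real"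
  proof -
    have "(\<integral>\<^sup>+z. ennreal (g (dist (fst z) (snd z))) \<partial>(\<nu> \<Otimes>\<^sub>M \<nu>)) = (\<integral>\<^sup>+x. \<integral>\<^sup>+y. ennreal (g (dist x y)) \<partial>\<nu> \<partial>\<nu>)"
      using nn_integral_fst[of "\<lambda>z. ennreal (g (dist (fst z) (snd z)))" \<nu>] dist_pair_measurable[OF \<nu> that] by simp
    also have "\<dots> = (\<integral>\<^sup>+x. (\<Sum>y\<in>S. ennreal (1 / N) * ennreal (g (dist x y))) \<partial>\<nu>)"
      by (intro nn_integral_cong nn) measurable
    also have "\<dots> = (\<Sum>x\<in>S. ennreal (1 / N) * (\<Sum>y\<in>S. ennreal (1 / N) * ennreal (g (dist x y))))"
      by (intro nn) measurable
    finally show ?thesis by (simp add: sum_distrib_left)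
  qed
  define k where "k r = r powr \<alpha> / \<alpha> - r powr b / b" for r :: real
  have km: "k \<in> borel_measurable borel" unfolding k_def by measurable
  have kS: "k (dist x y) = (if x = y then 0 else - K)" if "x \<in> S" "y \<in> S" for x y
    using S(3)[OF that] b by (auto simp: k_def K_def)
  have pos: "(\<integral>\<^sup>+z. ennreal (k (dist (fst z) (snd z))) \<partial>(\<nu> \<Otimes>\<^sub>M \<nu>)) = 0"
    unfolding pair[OF km] using kS K by (auto simp: ennreal_neg intro!: sum.neutral)
  have "(\<integral>\<^sup>+z. ennreal (- k (dist (fst z) (snd z))) \<partial>(\<nu> \<Otimes>\<^sub>M \<nu>))
      = (\<Sum>x\<in>S. \<Sum>y\<in>S. ennreal (1 / N) * (ennreal (1 / N) * ennreal (- k (dist x y))))"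
    by (rule pair) (use km in measurable)
  also have "\<dots> = (\<Sum>x\<in>S. \<Sum>y\<in>S. ennreal (if x = y then 0 else K / N\<^sup>2))"
    using kS N(1) K by (intro sum.cong refl) (auto simp: ennreal_mult[symmetric] power2_eq_square)
  also have "\<dots> = ennreal (\<Sum>x\<in>S. \<Sum>y\<in>S. if x = y then 0 else K / N\<^sup>2)"
    using K by (simp add: sum_ennreal sum_nonneg)
  also have "(\<Sum>x\<in>S. \<Sum>y\<in>S. if x = y then 0 else K / N\<^sup>2) = (\<Sum>x\<in>S. \<Sum>y\<in>S. K / N\<^sup>2 - (if x = y then K / N\<^sup>2 else 0))"
    by (intro sum.cong) auto
  also have "\<dots> = K * ((N - 1) / N)"
    using S(1) N(1) by (simp add: sum_subtractf N(2)) (simp add: field_simps power2_eq_square)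
  finally have neg: "(\<integral>\<^sup>+z. ennreal (- k (dist (fst z) (snd z))) \<partial>(\<nu> \<Otimes>\<^sub>M \<nu>)) = ennreal (K * ((N - 1) / N))" .
  have N1: "N \<ge> 1" by (simp add: N_def)
  show "energy \<alpha> b \<nu> = ereal (- (1 / 2) * ((1 / b - 1 / \<alpha>) * (DIM('a) / (DIM('a) + 1))))"
    using pos neg K N1
    unfolding energy_def kernel_dist k_def[symmetric] case_prod_beta K_def[symmetric]
    by (simp add: N(3) N_def[symmetric] enn2ereal_ennreal add.commute zero_ennreal.rep_eq)
qed

lemma energy_translate:
  fixes M :: "'a::euclidean_space measure"
  assumes M: "M \<in> prob_measures"
  shows "distr M borel (\<lambda>x. x - c) \<in> prob_measures"
    and "energy \<alpha> b (distr M borel (\<lambda>x. x - c)) = energy \<alpha> b M"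
proof -
  interpret prob_space M using M by (simp add: prob_measures_iff)
  have sM[measurable_cong]: "sets M = sets borel" using M by (auto simp: prob_measures_iff)
  have t: "(\<lambda>x. x - c) \<in> measurable M borel" by measurable
  have p: "prob_space (distr M borel (\<lambda>x. x - c))" by (rule prob_space_distr[OF t])
  then show D: "distr M borel (\<lambda>x. x - c) \<in> prob_measures" unfolding prob_measures_iff by simp
  interpret D: prob_space "distr M borel (\<lambda>x. x - c)" by (rule p)
  have pd: "distr M borel (\<lambda>x. x - c) \<Otimes>\<^sub>M distr M borel (\<lambda>x. x - c)
     = distr (M \<Otimes>\<^sub>M M) (borel \<Otimes>\<^sub>M borel) (\<lambda>(x, y). (x - c, y - c))"
    by (rule pair_measure_distr[OF t t]) unfold_locales
  have tt: "(\<lambda>(x, y). (x - c, y - c)) \<in> measurable (M \<Otimes>\<^sub>M M) (borel \<Otimes>\<^sub>M borel)" by measurable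
  have "(\<integral>\<^sup>+z. ennreal (g (dist (fst z) (snd z))) \<partial>(distr M borel (\<lambda>x. x - c) \<Otimes>\<^sub>M distr M borel (\<lambda>x. x - c)))
     = (\<integral>\<^sup>+z. ennreal (g (dist (fst z) (snd z))) \<partial>(M \<Otimes>\<^sub>M M))"
    if "g \<in> borel_measurable borel" for g :: "real \<Rightarrow> real"
  proof -
    have "(\<lambda>z. g (dist (fst z) (snd z))) \<in> borel_measurable (borel \<Otimes>\<^sub>M borel :: ('a \<times> 'a) measure)"
      using dist_pair_measurable[OF D that] by (simp cong: measurable_cong_sets)
    then show ?thesis unfolding pd using tt
      by (subst nn_integral_distr) (auto simp: case_prod_beta dist_norm)
  qed
  note * = this
  show "energy \<alpha> b (distr M borel (\<lambda>x. x - c)) = energy \<alpha> b M"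
    unfolding energy_def kernel_dist case_prod_beta
    by (subst (1 2) *) (simp_all)
qed

text \<open>The kernel is bounded below, so the negative part of its integral is finite. An upper bound on the
energy then makes the positive part finite too, and the extended-real difference becomes an ordinary
integral.\<close>

lemma finite_energy_integral:
  fixes M :: "'a::euclidean_space measure"
  assumes M: "M \<in> prob_measures" and \<alpha>: "\<alpha> \<ge> 3" and b: "0 < b" "b \<le> 2"
    and E: "energy \<alpha> b M \<le> ereal e"
  shows "integrable (M \<Otimes>\<^sub>M M) (\<lambda>z. kernel \<alpha> b (fst z) (snd z))"
    and "(\<integral>z. kernel \<alpha> b (fst z) (snd z) \<partial>(M \<Otimes>\<^sub>M M)) \<le> 2 * e"
proof -
  interpret prob_space M using M by (simp add: prob_measures_iff)
  interpret P: pair_prob_space M M ..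
  define K where "K = 1 / b - 1 / \<alpha>"
  define k where "k z = kernel \<alpha> b (fst z) (snd z)" for z :: "'a \<times> 'a"
  have km: "k \<in> borel_measurable (M \<Otimes>\<^sub>M M)" unfolding k_def by (rule kernel_pair_measurable[OF M])
  have kK: "- k z \<le> K" for z
    using kernel_lower_bound[OF \<alpha> b, of "fst z" "snd z"] by (simp add: k_def K_def)
  define p where "p = (\<integral>\<^sup>+z. ennreal (k z) \<partial>(M \<Otimes>\<^sub>M M))"
  define q where "q = (\<integral>\<^sup>+z. ennreal (- k z) \<partial>(M \<Otimes>\<^sub>M M))"
  have "q \<le> (\<integral>\<^sup>+z. ennreal K \<partial>(M \<Otimes>\<^sub>M M))"
    unfolding q_def by (intro nn_integral_mono ennreal_leI kK)
  also have "\<dots> = ennreal K" by (simp add: P.emeasure_space_1)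
  finally have "q \<noteq> \<infinity>" by (auto simp: top_unique)
  then obtain c where c: "q = ennreal c" "c \<ge> 0" by (cases q) auto
  have E': "ereal (1 / 2) * (enn2ereal p - enn2ereal q) \<le> ereal e"
    using E unfolding energy_def p_def q_def k_def case_prod_beta .
  have "p \<noteq> \<infinity>"
  proof
    assume "p = \<infinity>"
    then show False using E' c by (simp add: enn2ereal_ennreal)
  qed
  then obtain a where a: "p = ennreal a" "a \<ge> 0" by (cases p) auto
  have ac: "(a - c) / 2 \<le> e" using E' a c by (simp add: enn2ereal_ennreal)
  have i: "integrable (M \<Otimes>\<^sub>M M) k"
    unfolding real_integrable_def using km a c by (simp flip: p_def q_def)
  then show "integrable (M \<Otimes>\<^sub>M M) (\<lambda>z. kernel \<alpha> b (fst z) (snd z))" unfolding k_def .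
  have "(\<integral>z. k z \<partial>(M \<Otimes>\<^sub>M M)) = a - c"
    unfolding real_lebesgue_integral_def[OF i] p_def[symmetric] q_def[symmetric] using a c by simp
  then show "(\<integral>z. kernel \<alpha> b (fst z) (snd z) \<partial>(M \<Otimes>\<^sub>M M)) \<le> 2 * e"
    using ac unfolding k_def by simp
qed

text \<open>A unit simplex is an admissible competitor. Replacing the kernel by the limit kernel costs at most
\<open>c = 1 / b - 1 / 2\<close>, of which the fraction \<open>n / (n + 1)\<close> is recovered from the energy of the competitor.
In the limit kernel \<open>r\<^sup>2 / 2\<close> is at most a quarter of \<open>r powr \<alpha> / \<alpha>\<close> plus a constant, so the moment of
order \<open>\<alpha>\<close> is finite.\<close>

lemma energy_minimizer_properties:
  fixes M :: "(real ^ 'n) measure"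
  assumes M: "M \<in> energy_minimizers \<alpha> b" and \<alpha>: "\<alpha> \<ge> 3" and b: "0 < b" "b \<le> 2"
  shows "has_distance_moment \<alpha> M"
    and "limit_energy \<alpha> M \<le> - (1 / 2 - 1 / \<alpha>) * (CARD('n) / (CARD('n) + 1)) + (1 / b - 1 / 2) / (CARD('n) + 1)"
proof -
  have Mp: "M \<in> prob_measures" using M by (simp add: energy_minimizers_def)
  interpret prob_space M using Mp by (simp add: prob_measures_iff)
  interpret P: pair_prob_space M M ..
  obtain S :: "(real ^ 'n) set" where S: "finite S" "card S = CARD('n) + 1"
    "\<And>x y. x \<in> S \<Longrightarrow> y \<in> S \<Longrightarrow> x \<noteq> y \<Longrightarrow> dist x y = 1"
    using exists_unit_simplex by metis
  define q where "q = CARD('n) / (CARD('n) + 1)"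
  have q: "1 - q = 1 / (CARD('n) + 1)" by (simp add: q_def field_simps)
  have dim: "DIM(real^'n) = CARD('n)" by simp
  note sim = energy_unit_simplex[OF S(1) _ S(3) b \<alpha>, unfolded dim, OF S(2)]
  define e where "e = - (1 / 2) * ((1 / b - 1 / \<alpha>) * q)"
  have "energy \<alpha> b M \<le> energy \<alpha> b (distr (uniform_count_measure S) borel (\<lambda>x. x))"
    using M sim(1) unfolding energy_minimizers_def by simp
  also have "\<dots> = ereal e" unfolding e_def q_def by (rule sim(2))
  finally have E: "energy \<alpha> b M \<le> ereal e" .
  note k = finite_energy_integral[OF Mp \<alpha> b E]
  define c where "c = 1 / b - 1 / 2"
  have ge: "dist (fst z) (snd z) powr \<alpha> / \<alpha> - (dist (fst z) (snd z))\<^sup>2 / 2 \<le> kernel \<alpha> b (fst z) (snd z) + c" for z :: "(real^'n) \<times> (real^'n)"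
    using kernel_ge_limit_kernel[OF b, of "fst z" "snd z" \<alpha>] by (simp add: c_def)
  have i: "integrable (M \<Otimes>\<^sub>M M) (\<lambda>z. dist (fst z) (snd z) powr \<alpha>)"
  proof (rule Bochner_Integration.integrable_bound)
    show "integrable (M \<Otimes>\<^sub>M M) (\<lambda>z. 4 * \<alpha> / 3 * (kernel \<alpha> b (fst z) (snd z) + c + 2 * \<alpha>\<^sup>2))" using k(1) by simp
    show "(\<lambda>z. dist (fst z) (snd z) powr \<alpha>) \<in> borel_measurable (M \<Otimes>\<^sub>M M)"
      by (rule dist_pair_measurable[OF Mp]) simp
    have "dist (fst z) (snd z) powr \<alpha> \<le> 4 * \<alpha> / 3 * (kernel \<alpha> b (fst z) (snd z) + c + 2 * \<alpha>\<^sup>2)" for z :: "(real^'n) \<times> (real^'n)"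
    proof -
      define r where "r = dist (fst z) (snd z)"
      have "r\<^sup>2 \<le> r powr \<alpha> / (2 * \<alpha>) + 4 * \<alpha>\<^sup>2" by (rule square_le_powr[OF \<alpha>]) (simp add: r_def)
      moreover have "r powr \<alpha> / \<alpha> - r\<^sup>2 / 2 \<le> kernel \<alpha> b (fst z) (snd z) + c" using ge unfolding r_def .
      moreover have "r powr \<alpha> / (2 * \<alpha>) = (r powr \<alpha> / \<alpha>) / 2" by simp
      ultimately have "3 / 4 * (r powr \<alpha> / \<alpha>) \<le> kernel \<alpha> b (fst z) (snd z) + c + 2 * \<alpha>\<^sup>2" by linarith
      then have "4 * \<alpha> / 3 * (3 / 4 * (r powr \<alpha> / \<alpha>)) \<le> 4 * \<alpha> / 3 * (kernel \<alpha> b (fst z) (snd z) + c + 2 * \<alpha>\<^sup>2)"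
        using \<alpha> by (intro mult_left_mono) auto
      moreover have "4 * \<alpha> / 3 * (3 / 4 * (r powr \<alpha> / \<alpha>)) = r powr \<alpha>" using \<alpha> by simp
      ultimately show ?thesis by (simp add: r_def)
    qed
    then show "AE z in M \<Otimes>\<^sub>M M. norm (dist (fst z) (snd z) powr \<alpha>) \<le> norm (4 * \<alpha> / 3 * (kernel \<alpha> b (fst z) (snd z) + c + 2 * \<alpha>\<^sup>2))"
      by (intro AE_I2) (simp add: order_trans[OF _ abs_ge_self])
  qed
  then show D: "has_distance_moment \<alpha> M" using Mp by (simp add: has_distance_moment_def)
  have "limit_energy \<alpha> M \<le> (\<integral>z. kernel \<alpha> b (fst z) (snd z) + c \<partial>(M \<Otimes>\<^sub>M M))"
    unfolding limit_energy_def using k(1) by (intro integral_mono integrable_limit_kernel[OF \<alpha> D] ge) simp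
  also have "\<dots> \<le> 2 * e + c" using k by (simp add: P.prob_space)
  also have "2 * e + c = - (1 / 2 - 1 / \<alpha>) * q + c * (1 - q)"
  proof -
    have "2 * (- (1 / 2) * ((x - y) * q)) + (x - 1 / 2) = - (1 / 2 - y) * q + (x - 1 / 2) * (1 - q)" for x y :: real
      by (simp add: field_simps)
    then show ?thesis unfolding e_def c_def .
  qed
  finally show "limit_energy \<alpha> M \<le> - (1 / 2 - 1 / \<alpha>) * (CARD('n) / (CARD('n) + 1)) + (1 / b - 1 / 2) / (CARD('n) + 1)"
    unfolding q c_def unfolding q_def by (simp only: times_divide_eq_right mult_1_right)
qed

lemma centered_minimizer:
  fixes M :: "(real ^ 'n) measure"
  assumes M: "M \<in> energy_minimizers \<alpha> b" and \<alpha>: "\<alpha> \<ge> 3" and b: "0 < b" "b \<le> 2"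
  shows "centered M \<in> energy_minimizers \<alpha> b" and "(\<integral>x. x \<partial>centered M) = 0"
proof -
  have Mp: "M \<in> prob_measures" using M by (simp add: energy_minimizers_def)
  interpret prob_space M using Mp by (simp add: prob_measures_iff)
  have sM[measurable_cong]: "sets M = sets borel" using Mp by (auto simp: prob_measures_iff)
  show "centered M \<in> energy_minimizers \<alpha> b"
  proof -
    have "energy \<alpha> b (centered M) = energy \<alpha> b M" "centered M \<in> prob_measures"
      unfolding centered_def by (rule energy_translate[OF Mp])+
    then show ?thesis using M unfolding energy_minimizers_def by simp
  qed
  have "integrable M (\<lambda>x. norm x)"
    using integrable_norm_power[OF energy_minimizer_properties(1)[OF M \<alpha> b], of 1] \<alpha> by simp
  then have ix: "integrable M (\<lambda>x. x)" by (rule integrable_norm_cancel) simp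
  have t: "(\<lambda>x. x - (\<integral>y. y \<partial>M)) \<in> measurable M borel" by measurable
  have "(\<integral>x. x \<partial>centered M) = (\<integral>x. x - (\<integral>y. y \<partial>M) \<partial>M)"
    unfolding centered_def by (rule integral_distr[OF t]) simp
  also have "\<dots> = (\<integral>x. x \<partial>M) - (\<integral>x. (\<integral>y. y \<partial>M) \<partial>M)"
    by (rule Bochner_Integration.integral_diff[OF ix]) simp
  also have "\<dots> = 0" by (simp add: prob_space)
  finally show "(\<integral>x. x \<partial>centered M) = 0" .
qed

section \<open>Convergence of minimizers to unit simplices\<close>

theorem theorem3p5:
  fixes \<alpha> :: real
    and \<beta> :: "nat \<Rightarrow> real"
    and \<mu> :: "nat \<Rightarrow> (real ^ 'n) measure"
  assumes alpha: "(CARD('n) = 1 \<and> \<alpha> \<ge> 3) \<or> (CARD('n) \<ge> 2 \<and> \<alpha> > 4)"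
    and beta_range: "\<And>m. \<beta> m \<in> {1<..<2}"
    and beta_mono: "incseq \<beta>"
    and beta_lim: "\<beta> \<longlonglongrightarrow> 2"
    and minimizer: "\<And>m. \<mu> m \<in> energy_minimizers \<alpha> (\<beta> m)"
  shows "\<forall>r :: nat \<Rightarrow> nat. strict_mono r \<longrightarrow>
           (\<exists>s :: nat \<Rightarrow> nat. \<exists>\<nu>. strict_mono s \<and> regular_unit_simplex \<nu> \<and>
              weakly_converges (\<lambda>k. centered (\<mu> (r (s k)))) \<nu>)"
proof (intro allI impI)
  fix r :: "nat \<Rightarrow> nat" assume r: "strict_mono r"
  have \<alpha>: "\<alpha> \<ge> 3" using alpha by auto
  define \<kappa> where "\<kappa> = 1 / 2 - 1 / \<alpha>"
  have \<kappa>: "\<kappa> > 0" using \<alpha> by (simp add: \<kappa>_def field_simps)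
  define M where "M k = centered (\<mu> (r k))" for k
  define \<delta> where "\<delta> k = (1 / \<beta> (r k) - 1 / 2) / (CARD('n) + 1)" for k
  have b: "0 < \<beta> k" "\<beta> k \<le> 2" for k using beta_range[of k] by auto
  note cm = centered_minimizer[OF minimizer \<alpha> b]
  have D: "has_distance_moment \<alpha> (M k)" for k
    unfolding M_def by (rule energy_minimizer_properties(1)[OF cm(1) \<alpha> b])
  have J: "limit_energy \<alpha> (M k) \<le> - \<kappa> * (CARD('n) / (CARD('n) + 1)) + \<delta> k" for k
    unfolding M_def \<delta>_def \<kappa>_def by (rule energy_minimizer_properties(2)[OF cm(1) \<alpha> b])
  have mean: "(\<integral>x. x \<partial>M k) = 0" for k unfolding M_def by (rule cm(2))
  have Mp: "M k \<in> prob_measures" for k using D by (simp add: has_distance_moment_def)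
  have "(\<lambda>k. \<beta> (r k)) \<longlonglongrightarrow> 2" using LIMSEQ_subseq_LIMSEQ[OF beta_lim r] by (simp add: comp_def)
  then have "\<delta> \<longlonglongrightarrow> (1 / 2 - 1 / 2) / (CARD('n) + 1)"
    unfolding \<delta>_def[abs_def] by (intro tendsto_intros) auto
  then have \<delta>: "\<delta> \<longlonglongrightarrow> 0" by simp
  have dim: "DIM(real^'n) = CARD('n)" by simp
  have off: "(\<lambda>k. measure (M k \<Otimes>\<^sub>M M k) (off_simplex e)) \<longlonglongrightarrow> 0" if e: "e > 0" for e
  proof (rule order_tendstoI)
    fix \<eta> :: real assume \<eta>: "0 < \<eta>"
    define e' where "e' = min e (1 / 2)"
    have e': "0 < e'" "e' < 1" "e' \<le> e" using e by (auto simp: e'_def)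
    have "\<exists>d>0. \<forall>N :: (real^'n) measure. has_distance_moment \<alpha> N \<longrightarrow> (\<integral>x. x \<partial>N) = 0 \<longrightarrow>
       limit_energy \<alpha> N \<le> - \<kappa> * (CARD('n) / (CARD('n) + 1)) + d \<longrightarrow>
       measure (N \<Otimes>\<^sub>M N) (off_simplex e') \<le> \<eta> / 2"
      using alpha
    proof
      assume "CARD('n) = 1 \<and> \<alpha> \<ge> 3"
      then show ?thesis unfolding \<kappa>_def dim[symmetric]
        by (intro off_simplex_small_of_cubic_growth) (use e' \<eta> in simp_all)
    next
      assume "CARD('n) \<ge> 2 \<and> \<alpha> > 4"
      then show ?thesis unfolding \<kappa>_def dim[symmetric]
        by (intro off_simplex_small_of_quartic_growth) (use e' \<eta> in simp_all)
    qed
    then obtain d where d: "d > 0" "\<forall>N :: (real^'n) measure. has_distance_moment \<alpha> N \<longrightarrow> (\<integral>x. x \<partial>N) = 0 \<longrightarrow>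
       limit_energy \<alpha> N \<le> - \<kappa> * (CARD('n) / (CARD('n) + 1)) + d \<longrightarrow>
       measure (N \<Otimes>\<^sub>M N) (off_simplex e') \<le> \<eta> / 2"
      by (elim exE conjE) (rule that)
    from order_tendstoD(2)[OF \<delta> d(1)]
    show "\<forall>\<^sub>F k in sequentially. measure (M k \<Otimes>\<^sub>M M k) (off_simplex e) < \<eta>"
    proof eventually_elim
      case (elim k)
      interpret prob_space "M k" using Mp by (simp add: prob_measures_iff)
      interpret P: pair_prob_space "M k" "M k" ..
      have "measure (M k \<Otimes>\<^sub>M M k) (off_simplex e) \<le> measure (M k \<Otimes>\<^sub>M M k) (off_simplex e')"
        by (rule P.finite_measure_mono[OF _ off_simplex_sets[OF Mp]]) (use e'(3) in auto)
      also have "\<dots> \<le> \<eta> / 2" by (rule d(2)[rule_format, OF D mean order_trans[OF J]]) (use elim in simp)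
      finally show ?case using \<eta> by linarith
    qed
  qed (rule always_eventually, rule allI, rule order_less_le_trans[OF _ measure_nonneg])
  have near: "\<exists>\<rho>>0. \<forall>\<^sub>F k in sequentially.
      measure (M k \<Otimes>\<^sub>M M k) {z. dist (fst z) (snd z) \<le> \<rho>} \<le> 1 / (CARD('n) + 1) + d" if d: "d > 0" for d
  proof (intro exI conjI)
    \<comment> \<open>Then \<open>\<rho>\<^sup>2 / 2\<close> uses up one half of the allowed error \<open>d * \<kappa>\<close>, and \<open>\<delta> k\<close> the other half.\<close>
    define \<rho> where "\<rho> = sqrt (d * \<kappa>)"
    show "\<rho> > 0" using d \<kappa> by (simp add: \<rho>_def)
    have \<rho>2: "\<rho>\<^sup>2 = d * \<kappa>" using d \<kappa> by (simp add: \<rho>_def)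
    have "\<forall>\<^sub>F k in sequentially. \<delta> k < d * \<kappa> / 2" by (rule order_tendstoD(2)[OF \<delta>]) (use d \<kappa> in simp)
    then show "\<forall>\<^sub>F k in sequentially.
      measure (M k \<Otimes>\<^sub>M M k) {z. dist (fst z) (snd z) \<le> \<rho>} \<le> 1 / (CARD('n) + 1) + d"
    proof eventually_elim
      case (elim k)
      have "measure (M k \<Otimes>\<^sub>M M k) {z. dist (fst z) (snd z) \<le> \<rho>} \<le> 1 / (CARD('n) + 1) + (\<delta> k + \<rho>\<^sup>2 / 2) / \<kappa>"
        using near_diagonal_mass_le[OF \<alpha> D \<open>\<rho> > 0\<close> J[unfolded \<kappa>_def dim[symmetric]]] unfolding dim \<kappa>_def .
      also have "(\<delta> k + \<rho>\<^sup>2 / 2) / \<kappa> \<le> d" using elim \<kappa> unfolding \<rho>2 by (simp add: divide_le_eq)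
      finally show ?case by simp
    qed
  qed
  have norm1: "integrable (M k) norm" for k by (rule first_moment_le(1)[OF \<alpha> D mean])
  have norm2: "(\<integral>x. norm x \<partial>M k) \<le> 1 + (1 + 8 * \<alpha>\<^sup>2)" for k
  proof -
    have "1 / \<beta> (r k) \<le> 1" using beta_range[of "r k"] by (simp add: divide_le_eq)
    then have "1 / \<beta> (r k) - 1 / 2 \<le> real (CARD('n) + 1)" by simp
    then have "\<delta> k \<le> 1" unfolding \<delta>_def by (intro divide_le_eq_1_pos[THEN iffD2]) simp_all
    moreover have "0 \<le> \<kappa> * (CARD('n) / (CARD('n) + 1))" using \<kappa> by simp
    ultimately show ?thesis using first_moment_le(2)[OF \<alpha> D mean, of k] J[of k] by linarith
  qed
  show "\<exists>s \<nu>. strict_mono s \<and> regular_unit_simplex \<nu> \<and> weakly_converges (\<lambda>k. centered (\<mu> (r (s k)))) \<nu>"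
    using weak_limit_is_unit_simplex[OF Mp off near norm1 norm2] unfolding M_def .
qed

end
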